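(* Let $\widetilde{x}_0, \widetilde{z}_0 \in \mathbb{R}^d$, $\gamma \geq 3$, $m \in \mathbb{N}$, $b \in [n]$ and $S \in \mathbb{N}$ (with $m,S\ge 1$). Let $\eta = \frac{1}{(1+\gamma(m+1)/b)\bar L}$ and let $\widetilde{x}_S$ be the output of $\mathrm{DASVRDA}^{\mathrm{ns}}(\widetilde{x}_{0}, \widetilde{z}_0, \gamma, \{ L_i \}_{i=1}^n, m, b, S)$. Then $$\mathbb{E}\left[P(\widetilde{x}_{S})-P(x_{*})\right] \leq \frac{4}{(S+2)^2}\left(P(\widetilde{x}_0)-P(x_* )\right) + \frac{8}{\left(1 - \frac{1}{\gamma}\right)^2\eta(S+2)^2(m+1)m}\| \widetilde{z}_0 - x_* \|^2 .$$
   Context: Setting. $n,d\ge 1$, $[n]=\{1,\dots,n\}$, $\|\cdot\|$ is the Euclidean norm on $\mathbb{R}^d$. Each $f_i:\mathbb{R}^d\to\mathbb{R}$ ($i\in[n]$) is convex, differentiable and $L_i$-smooth with $L_i>0$, i.e. $\|\nabla f_i(x)-\nabla f_i(y)\|\le L_i\|x-y\|$ for all $x,y$. $F=\frac1n\sum_{i=1}^n f_i$. $R:\mathbb{R}^d\to\mathbb{R}$ is convex (possibly non-differentiable) and relatively simple (its proximal mapping is computable at $O(d)$ cost). $P=F+R$, and $x_*$ is a minimizer of $P$, assumed to exist. $\bar L=\frac1n\sum_{i=1}^n L_i$, and $Q=\{q_i\}_{i=1}^n$ is the probability distribution on $[n]$ with $q_i=\frac{L_i}{n\bar L}$. $\mathrm{prox}_{f}(y)=\mathrm{argmin}_{x}\{\frac12\|x-y\|^2+f(x)\}$.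 Procedure One Stage AccSVRDA$(\widetilde y,\widetilde x,\eta,m,b,Q)$: set $x_0=z_0=\widetilde y$, $\bar g_0=0$, $\theta_0=\frac12$. For $k=1,\dots,m$: draw $i_k^1,\dots,i_k^b$ independently from $Q$ (independently of the past), let $I_k$ be this sample of $b$ indices (with multiplicity); $\theta_k=\frac{k+1}{2}$; $y_k=(1-\frac1{\theta_k})x_{k-1}+\frac1{\theta_k}z_{k-1}$; $g_k=\frac1b\sum_{i\in I_k}\frac{1}{nq_i}(\nabla f_i(y_k)-\nabla f_i(\widetilde x))+\nabla F(\widetilde x)$; $\bar g_k=(1-\frac1{\theta_k})\bar g_{k-1}+\frac1{\theta_k}g_k$; $z_k=\mathrm{argmin}_{z}\{\langle \bar g_k,z\rangle+R(z)+\frac{1}{2\eta\theta_k\theta_{k-1}}\|z-z_0\|^2\}=\mathrm{prox}_{\eta\theta_k\theta_{k-1}R}(z_0-\eta\theta_k\theta_{k-1}\bar g_k)$; $x_k=(1-\frac1{\theta_k})x_{k-1}+\frac1{\theta_k}z_k$. Output $(x_m,z_m)$. Procedure $\mathrm{DASVRDA}^{\mathrm{ns}}(\widetilde x_0,\widetilde z_0,\gamma,\{L_i\},m,b,S)$ ($\gamma>1$): set $\widetilde x_{-1}=\widetilde z_0$, $\widetilde\theta_0=1-\frac1\gamma$, $\eta=\frac{1}{(1+\gamma(m+1)/b)\bar L}$. For $s=1,\dots,S$: $\widetilde\theta_s=(1-\frac1\gamma)\frac{s+2}{2}$; $\widetilde y_s=\widetilde x_{s-1}+\frac{\widetilde\theta_{s-1}-1}{\widetilde\theta_s}(\widetilde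 x_{s-1}-\widetilde x_{s-2})+\frac{\widetilde\theta_{s-1}}{\widetilde\theta_s}(\widetilde z_{s-1}-\widetilde x_{s-1})$; $(\widetilde x_s,\widetilde z_s)=$ One Stage AccSVRDA$(\widetilde y_s,\widetilde x_{s-1},\eta,m,b,Q)$ with fresh independent samples. Output $\widetilde x_S$. Expectation is over all random index draws. *)

theory Defs
  imports "HOL-Probability.Probability"
begin

definition gradient :: "('a::real_inner \<Rightarrow> real) \<Rightarrow> 'a \<Rightarrow> 'a" where
  "gradient f x = (THE D. GDERIV f x :> D)"

lemma gradient_eqI: "GDERIV f x :> D \<Longrightarrow> gradient f x = D"
  unfolding gradient_def
proof (rule the_equality)
  fix D' assume "GDERIV f x :> D" "GDERIV f x :> D'"
  hence "(\<lambda>h. inner h D') = (\<lambda>h. inner h D)"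
    unfolding gderiv_def by (rule has_derivative_unique[rotated])
  hence "\<And>h. inner h (D' - D) = 0"
    by (simp add: inner_diff_right fun_eq_iff)
  from this[of "D' - D"] show "D' = D" by simp
qed

definition average :: "nat \<Rightarrow> (nat \<Rightarrow> 'a \<Rightarrow> real) \<Rightarrow> 'a \<Rightarrow> real" where
  "average n f x = (1 / real n) * (\<Sum>i = 1..n. f i x)"

definition mean_smoothness :: "nat \<Rightarrow> (nat \<Rightarrow> real) \<Rightarrow> real" where
  "mean_smoothness n L = (1 / real n) * (\<Sum>i = 1..n. L i)"

text \<open>The importance-sampling distribution \<open>Q\<close> on \<open>{1..n}\<close>. The underlying \<open>embed_pmf\<close> is
  meaningful for \<open>n \<ge> 1\<close> and positive \<open>L i\<close>, as the next lemma confirms.\<close>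

definition sampling_pmf :: "nat \<Rightarrow> (nat \<Rightarrow> real) \<Rightarrow> nat pmf" where
  "sampling_pmf n L =
     embed_pmf (\<lambda>i. if i \<in> {1..n} then L i / (real n * mean_smoothness n L) else 0)"

lemma pmf_sampling_pmf:
  assumes n: "n \<ge> 1" and L: "\<And>i. i \<in> {1..n} \<Longrightarrow> L i > 0"
  shows "pmf (sampling_pmf n L) i =
           (if i \<in> {1..n} then L i / (real n * mean_smoothness n L) else 0)"
  unfolding sampling_pmf_def
proof (rule pmf_embed_pmf)
  let ?q = "\<lambda>i. if i \<in> {1..n} then L i / (real n * mean_smoothness n L) else 0"
  have nL: "real n * mean_smoothness n L = (\<Sum>i = 1..n. L i)"
    using n by (simp add: mean_smoothness_def)
  have pos: "(\<Sum>i = 1..n. L i) > 0"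
    using n L by (intro sum_pos) auto
  show nonneg: "0 \<le> ?q i" for i
    using L[of i] pos by (auto simp: nL simp del: atLeastAtMost_iff intro!: divide_nonneg_pos less_imp_le)
  have "(\<integral>\<^sup>+i. ennreal (?q i) \<partial>count_space UNIV) = (\<Sum>i = 1..n. ennreal (?q i))"
    by (rule nn_integral_count_space') auto
  also have "\<dots> = ennreal (\<Sum>i = 1..n. ?q i)"
    by (rule sum_ennreal) (rule nonneg)
  also have "(\<Sum>i = 1..n. ?q i) = (\<Sum>i = 1..n. L i / (\<Sum>i = 1..n. L i))"
    unfolding nL by (intro sum.cong) auto
  also have "\<dots> = 1"
    using pos by (simp flip: sum_divide_distrib)
  finally show "(\<integral>\<^sup>+i. ennreal (?q i) \<partial>count_space UNIV) = 1" by simp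
qed

text \<open>The formula gives \<open>\<theta> 0 = 1 / 2\<close>, so the initial value needs no separate case.\<close>

definition theta :: "nat \<Rightarrow> real" where
  "theta k = (real k + 1) / 2"

text \<open>The mini-batch is a list of indices, so that multiplicities are retained.\<close>

definition svrg_estimate ::
  "nat \<Rightarrow> (nat \<Rightarrow> 'a::real_inner \<Rightarrow> real) \<Rightarrow> nat \<Rightarrow> nat pmf \<Rightarrow> 'a \<Rightarrow> nat list \<Rightarrow> 'a \<Rightarrow> 'a" where
  "svrg_estimate n f b Q xt I y =
     (1 / real b) *\<^sub>R (\<Sum>i\<leftarrow>I. (1 / (real n * pmf Q i)) *\<^sub>R (gradient (f i) y - gradient (f i) xt))
       + gradient (average n f) xt"

text \<open>Iteration \<open>k\<close>, with the sample \<open>I\<close> already drawn, acts on the state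
  \<open>(x\<^sub>k\<^sub>-\<^sub>1, z\<^sub>k\<^sub>-\<^sub>1, g\<^sub>k\<^sub>-\<^sub>1)\<close>, whose last component is the running average of the gradient
  estimates. The proximal centre \<open>yt\<close> is \<open>z\<^sub>0\<close>.\<close>

definition accsvrda_step ::
  "nat \<Rightarrow> (nat \<Rightarrow> 'a::real_inner \<Rightarrow> real) \<Rightarrow> ('a \<Rightarrow> real) \<Rightarrow> 'a \<Rightarrow> 'a \<Rightarrow> real \<Rightarrow> nat \<Rightarrow> nat pmf \<Rightarrow>
   nat \<Rightarrow> nat list \<Rightarrow> 'a \<times> 'a \<times> 'a \<Rightarrow> 'a \<times> 'a \<times> 'a" where
  "accsvrda_step n f R yt xt \<eta> b Q k I = (\<lambda>(x, z, gbar).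
     let t  = 1 / theta k;
         y  = (1 - t) *\<^sub>R x + t *\<^sub>R z;
         g  = svrg_estimate n f b Q xt I y;
         gbar' = (1 - t) *\<^sub>R gbar + t *\<^sub>R g;
         z' = arg_min (\<lambda>u. inner gbar' u + R u
                          + 1 / (2 * \<eta> * theta k * theta (k - 1)) * (norm (u - yt))\<^sup>2) (\<lambda>_. True);
         x' = (1 - t) *\<^sub>R x + t *\<^sub>R z'
     in (x', z', gbar'))"

primrec accsvrda_iter ::
  "nat \<Rightarrow> (nat \<Rightarrow> 'a::real_inner \<Rightarrow> real) \<Rightarrow> ('a \<Rightarrow> real) \<Rightarrow> 'a \<Rightarrow> 'a \<Rightarrow> real \<Rightarrow> nat \<Rightarrow> nat pmf \<Rightarrow>
   nat \<Rightarrow> ('a \<times> 'a \<times> 'a) pmf" where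
  "accsvrda_iter n f R yt xt \<eta> b Q 0 = return_pmf (yt, yt, 0)"
| "accsvrda_iter n f R yt xt \<eta> b Q (Suc k) =
     do { st \<leftarrow> accsvrda_iter n f R yt xt \<eta> b Q k;
          I \<leftarrow> replicate_pmf b Q;
          return_pmf (accsvrda_step n f R yt xt \<eta> b Q (Suc k) I st) }"

definition one_stage_accsvrda ::
  "nat \<Rightarrow> (nat \<Rightarrow> 'a::real_inner \<Rightarrow> real) \<Rightarrow> ('a \<Rightarrow> real) \<Rightarrow>
   'a \<Rightarrow> 'a \<Rightarrow> real \<Rightarrow> nat \<Rightarrow> nat \<Rightarrow> nat pmf \<Rightarrow> ('a \<times> 'a) pmf" where
  "one_stage_accsvrda n f R yt xt \<eta> m b Q =
     map_pmf (\<lambda>(x, z, gbar). (x, z)) (accsvrda_iter n f R yt xt \<eta> b Q m)"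

text \<open>The formula gives the prescribed initial value \<open>1 - 1 / \<gamma>\<close> at \<open>s = 0\<close>.\<close>

definition outer_theta :: "real \<Rightarrow> nat \<Rightarrow> real" where
  "outer_theta \<gamma> s = (1 - 1 / \<gamma>) * (real s + 2) / 2"

definition step_size :: "nat \<Rightarrow> (nat \<Rightarrow> real) \<Rightarrow> real \<Rightarrow> nat \<Rightarrow> nat \<Rightarrow> real" where
  "step_size n L \<gamma> m b = 1 / ((1 + \<gamma> * (real m + 1) / real b) * mean_smoothness n L)"

definition outer_extrapolation ::
  "real \<Rightarrow> nat \<Rightarrow> 'a::real_vector \<Rightarrow> 'a \<Rightarrow> 'a \<Rightarrow> 'a" where
  "outer_extrapolation \<gamma> s xpp xp zp =
     xp + ((outer_theta \<gamma> (s - 1) - 1) / outer_theta \<gamma> s) *\<^sub>R (xp - xpp)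
        + (outer_theta \<gamma> (s - 1) / outer_theta \<gamma> s) *\<^sub>R (zp - xp)"

text \<open>The state after \<open>s\<close> stages consists of the outer iterates \<open>x\<^sub>s\<^sub>-\<^sub>1\<close>, \<open>x\<^sub>s\<close> and \<open>z\<^sub>s\<close>, where
  \<open>x\<^sub>-\<^sub>1\<close> is \<open>z\<^sub>0\<close>.\<close>

primrec dasvrda_ns_iter ::
  "nat \<Rightarrow> (nat \<Rightarrow> 'a::real_inner \<Rightarrow> real) \<Rightarrow> ('a \<Rightarrow> real) \<Rightarrow>
   'a \<Rightarrow> 'a \<Rightarrow> real \<Rightarrow> (nat \<Rightarrow> real) \<Rightarrow> nat \<Rightarrow> nat \<Rightarrow> nat \<Rightarrow> ('a \<times> 'a \<times> 'a) pmf" where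
  "dasvrda_ns_iter n f R x0 z0 \<gamma> L m b 0 = return_pmf (z0, x0, z0)"
| "dasvrda_ns_iter n f R x0 z0 \<gamma> L m b (Suc s) =
     do { (xpp, xp, zp) \<leftarrow> dasvrda_ns_iter n f R x0 z0 \<gamma> L m b s;
          (x, z) \<leftarrow> one_stage_accsvrda n f R (outer_extrapolation \<gamma> (Suc s) xpp xp zp) xp
                     (step_size n L \<gamma> m b) m b (sampling_pmf n L);
          return_pmf (xp, x, z) }"

definition dasvrda_ns ::
  "nat \<Rightarrow> (nat \<Rightarrow> 'a::real_inner \<Rightarrow> real) \<Rightarrow> ('a \<Rightarrow> real) \<Rightarrow>
   'a \<Rightarrow> 'a \<Rightarrow> real \<Rightarrow> (nat \<Rightarrow> real) \<Rightarrow> nat \<Rightarrow> nat \<Rightarrow> nat \<Rightarrow> 'a pmf" where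
  "dasvrda_ns n f R x0 z0 \<gamma> L m b S =
     map_pmf (\<lambda>(xp, x, z). x) (dasvrda_ns_iter n f R x0 z0 \<gamma> L m b S)"

end

theory Submission
  imports Defs
begin

text \<open>
  The proof runs two nested potential arguments, both of which turn each random step into an
  inequality between conditional expectations. All distributions involved are finitely supported,
  so that integrability is automatic and conditioning is just \<open>expectation_bind_finite\<close>.

  Within a stage, let \<open>A\<^sub>k = k (k + 1) / 4\<close>. The running average \<open>G\<^sub>k\<close> of the
  gradient estimates satisfies \<open>A\<^sub>k G\<^sub>k = \<Sum>\<^sub>j (j / 2) g\<^sub>j\<close>, so \<open>z\<^sub>k\<close> minimises the model
  \<open>A\<^sub>k (\<langle>G\<^sub>k, w\<rangle> + R w) + \<parallel>w - yt\<parallel>\<^sup>2 / (2 \<eta>)\<close>, which grows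
  quadratically away from its minimiser. For a fixed reference point \<open>u\<close>, the potential is
  \<open>A\<^sub>k P x\<^sub>k\<close> plus the excess of the model at \<open>u\<close> over its minimum. Only the excess occurs, so
  the constant terms of the linearisations of \<open>F\<close> never have to be remembered. One step raises the
  potential by at most \<open>k / 2\<close> times the sum of \<open>R u\<close> and the linearisation of \<open>F\<close> at \<open>y\<^sub>k\<close>,
  evaluated at \<open>u\<close>, plus noise (\<open>stage_potential_step\<close>). The quadratic growth pays for the curvature of
  \<open>F\<close> and for the correlation between \<open>z\<^sub>k\<close> and the noise. In expectation the linear noise
  vanishes, and importance sampling together with the choice of \<open>\<eta>\<close> leaves at
  most \<open>k / 2\<close> times \<open>gradient_gap xt y\<^sub>k / (2 \<gamma>)\<close> (\<open>stage_potential_expected_step\<close>).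

  This remainder has to be absorbed. The reference point is
  \<open>u = (1 - 1 / \<theta>) xt + (1 / \<theta>) xstar\<close>, with \<open>\<theta>\<close> the outer momentum parameter. The
  linearisation at \<open>u\<close> lies below the corresponding average of \<open>F xt\<close> and \<open>F xstar\<close>, and the
  deficit is the same average of the Bregman divergences of \<open>F\<close> from \<open>y\<^sub>k\<close>. The gradient gap is at
  most the divergence of \<open>xt\<close>, so the deficit absorbs it as soon as
  \<open>1 / (2 \<gamma>) \<le> 1 - 1 / \<theta>\<close>. That holds from the second stage on, but can fail at the first,
  where \<open>\<theta> = 1\<close> when \<open>\<gamma> = 3\<close>. There the gap is instead routed through \<open>xstar\<close>:
  the part between \<open>xstar\<close> and \<open>y\<^sub>k\<close> is absorbed by the divergence of \<open>xstar\<close>, and the part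
  between \<open>xt\<close> and \<open>xstar\<close> costs \<open>(P xt - P xstar) / \<gamma>\<close>, for which the first stage has room
  (\<open>stage_target_bound\<close>, \<open>outer_theta_recursion\<close>).

  Across stages, the extrapolation is chosen so that the combined point
  \<open>v\<^sub>s = \<theta>\<^sub>s z\<^sub>s - (\<theta>\<^sub>s - 1) x\<^sub>s\<^sub>-\<^sub>1\<close> turns the distances to \<open>u\<close> at the start and at the end of a stage
  into the distances of \<open>v\<^sub>s\<^sub>-\<^sub>1\<close> and \<open>v\<^sub>s\<close> to \<open>xstar\<close>, up to the factor \<open>1 / \<theta>\<^sub>s\<close>. As
  \<open>\<theta>\<^sub>s\<close> is proportional to \<open>s + 2\<close>, the quantity
  \<open>(s + 2)\<^sup>2 (P x\<^sub>s - P xstar) + C \<parallel>v\<^sub>s - xstar\<parallel>\<^sup>2\<close> does not increase in expectation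
  (\<open>outer_potential_expected_step\<close>). It starts at
  \<open>4 (P x0 - P xstar) + C \<parallel>z0 - xstar\<parallel>\<^sup>2\<close>, and dividing by \<open>(S + 2)\<^sup>2\<close> gives the
  claim.
\<close>

section \<open>Smooth convex functions\<close>

lemma le_of_le_add_vanishing:
  fixes a b c :: real
  assumes "\<And>t. 0 < t \<Longrightarrow> t < 1 \<Longrightarrow> a \<le> b + t * c"
  shows "a \<le> b"
proof (rule tendsto_lowerbound)
  show "((\<lambda>t. b + t * c) \<longlongrightarrow> b) (at_right 0)"
    by (auto intro!: tendsto_eq_intros)
  show "\<forall>\<^sub>F t in at_right 0. a \<le> b + t * c"
    using eventually_at_right_real[OF zero_less_one] by eventually_elim (use assms in auto)
qed simp

lemma GDERIV_gradient:
  fixes f :: "'a::euclidean_space \<Rightarrow> real"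
  assumes "f differentiable (at x)"
  shows "GDERIV f x :> gradient f x"
proof -
  obtain f' where f': "(f has_derivative f') (at x)"
    using assms unfolding differentiable_def by blast
  interpret linear f'
    using f' by (rule has_derivative_linear)
  define D where "D = (\<Sum>b\<in>Basis. f' b *\<^sub>R b)"
  have "f' h = inner h D" for h
  proof -
    have "f' h = f' (\<Sum>b\<in>Basis. inner h b *\<^sub>R b)"
      by (simp add: euclidean_representation)
    also have "\<dots> = (\<Sum>b\<in>Basis. inner h b * f' b)"
      by (simp add: sum scale)
    also have "\<dots> = inner h D"
      by (simp add: D_def inner_sum_right mult.commute)
    finally show ?thesis .
  qed
  hence "f' = (\<lambda>h. inner h D)" by blast
  hence "GDERIV f x :> D" using f' unfolding gderiv_def by simp
  thus ?thesis using gradient_eqI by metis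
qed

lemma DERIV_along_line:
  fixes f :: "'a::euclidean_space \<Rightarrow> real"
  assumes "\<And>x. f differentiable (at x)"
  shows "((\<lambda>t. f (x + t *\<^sub>R h)) has_real_derivative inner h (gradient f (x + t *\<^sub>R h))) (at t)"
proof -
  have "(f has_derivative (\<lambda>k. inner k (gradient f (x + t *\<^sub>R h)))) (at (x + t *\<^sub>R h))"
    using GDERIV_gradient[OF assms] unfolding gderiv_def .
  moreover have "((\<lambda>t. x + t *\<^sub>R h) has_derivative (\<lambda>s. s *\<^sub>R h)) (at t)"
    by (auto intro!: derivative_eq_intros)
  ultimately have "((\<lambda>t. f (x + t *\<^sub>R h)) has_derivative
      (\<lambda>s. inner (s *\<^sub>R h) (gradient f (x + t *\<^sub>R h)))) (at t)"
    using has_derivative_compose by blast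
  thus ?thesis
    by (simp add: has_field_derivative_def mult.commute[of _ "inner h _"] mult_commute_abs)
qed

definition bregman :: "('a::real_inner \<Rightarrow> real) \<Rightarrow> 'a \<Rightarrow> 'a \<Rightarrow> real" where
  "bregman f x y = f x - f y - inner (gradient f y) (x - y)"

text \<open>Restricted to the segment from \<open>y\<close> to \<open>x\<close>, the claim is that a convex function of one real
  variable lies above its tangent.\<close>

lemma bregman_nonneg:
  fixes f :: "'a::euclidean_space \<Rightarrow> real"
  assumes conv: "convex_on UNIV f" and diff: "\<And>x. f differentiable (at x)"
  shows "0 \<le> bregman f x y"
proof -
  let ?\<phi> = "\<lambda>t. f (y + t *\<^sub>R (x - y))"
  have "convex_on UNIV ?\<phi>"
  proof (rule convex_onI)
    fix t s r :: real assume "0 < t" "t < 1"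
    have "y + ((1 - t) *\<^sub>R s + t *\<^sub>R r) *\<^sub>R (x - y)
        = (1 - t) *\<^sub>R (y + s *\<^sub>R (x - y)) + t *\<^sub>R (y + r *\<^sub>R (x - y))"
      by (simp add: algebra_simps)
    thus "?\<phi> ((1 - t) *\<^sub>R s + t *\<^sub>R r) \<le> (1 - t) * ?\<phi> s + t * ?\<phi> r"
      using convex_onD[OF conv, of t] \<open>0 < t\<close> \<open>t < 1\<close> by simp
  qed simp
  hence "?\<phi> 1 - ?\<phi> 0 \<ge> inner (x - y) (gradient f (y + 0 *\<^sub>R (x - y))) * (1 - 0)"
    by (rule convex_on_imp_above_tangent)
      (use DERIV_along_line[OF diff, of y "x - y" 0] in \<open>auto intro: has_field_derivative_at_within\<close>)
  thus ?thesis by (simp add: bregman_def inner_commute)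
qed

text \<open>Along the segment from \<open>y\<close> to \<open>x\<close>, the function minus its tangent at \<open>y\<close> has slope at
  most \<open>L t\<close> times the squared length, so subtracting the primitive of that bound makes it
  nonincreasing.\<close>

lemma bregman_le_of_lipschitz_gradient:
  fixes f :: "'a::euclidean_space \<Rightarrow> real"
  assumes diff: "\<And>x. f differentiable (at x)"
    and lip: "\<And>x y. norm (gradient f x - gradient f y) \<le> L * norm (x - y)"
  shows "bregman f x y \<le> L / 2 * (norm (x - y))\<^sup>2"
proof -
  define h where "h = x - y"
  define \<phi> where "\<phi> t = f (y + t *\<^sub>R h) - t * inner h (gradient f y) - L / 2 * (norm h)\<^sup>2 * t\<^sup>2" for t
  have "\<phi> 1 \<le> \<phi> 0"
  proof (rule DERIV_nonpos_imp_nonincreasing[of 0 1 \<phi>])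
    fix t :: real assume t: "0 \<le> t" "t \<le> 1"
    let ?D = "inner h (gradient f (y + t *\<^sub>R h)) - inner h (gradient f y) - L * (norm h)\<^sup>2 * t"
    have "(\<phi> has_real_derivative ?D) (at t)"
      unfolding \<phi>_def
      by (auto intro!: derivative_eq_intros DERIV_along_line diff)
    moreover have "?D \<le> 0"
    proof -
      have "inner h (gradient f (y + t *\<^sub>R h) - gradient f y)
          \<le> norm h * norm (gradient f (y + t *\<^sub>R h) - gradient f y)"
        by (rule norm_cauchy_schwarz)
      also have "\<dots> \<le> norm h * (L * norm (t *\<^sub>R h))"
        using lip[of "y + t *\<^sub>R h" y] by (intro mult_left_mono) simp_all
      also have "\<dots> = L * (norm h)\<^sup>2 * t"
        using t by (simp add: power2_eq_square)
      finally show ?thesis by (simp add: inner_diff_right)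
    qed
    ultimately show "\<exists>D. (\<phi> has_real_derivative D) (at t) \<and> D \<le> 0" by blast
  qed simp
  thus ?thesis by (simp add: \<phi>_def bregman_def h_def inner_commute)
qed

text \<open>Subtracting from \<open>f\<close> its tangent at \<open>y\<close> gives a smooth function minimised at \<open>y\<close> with
  value \<open>0\<close>; one gradient step of length \<open>1 / L\<close> from \<open>x\<close> decreases it by at least the
  left-hand side, and it cannot go below \<open>0\<close>.\<close>

lemma norm_gradient_diff_le_bregman:
  fixes f :: "'a::euclidean_space \<Rightarrow> real"
  assumes conv: "convex_on UNIV f" and diff: "\<And>x. f differentiable (at x)" and L: "L > 0"
    and lip: "\<And>x y. norm (gradient f x - gradient f y) \<le> L * norm (x - y)"
  shows "(norm (gradient f x - gradient f y))\<^sup>2 / (2 * L) \<le> bregman f x y"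
proof -
  define d where "d = gradient f x - gradient f y"
  define w where "w = x - (1 / L) *\<^sub>R d"
  have "bregman f w x \<le> L / 2 * (norm (w - x))\<^sup>2"
    by (rule bregman_le_of_lipschitz_gradient[OF diff lip])
  also have "\<dots> = (norm d)\<^sup>2 / (2 * L)"
    using L by (simp add: w_def power_divide power2_eq_square)
  finally have 1: "bregman f w x \<le> (norm d)\<^sup>2 / (2 * L)" .
  have "bregman f w y = bregman f w x + bregman f x y + inner d (w - x)"
    by (simp add: bregman_def d_def algebra_simps inner_diff_left inner_diff_right)
  moreover have "inner d (w - x) = - (norm d)\<^sup>2 / L"
    by (simp add: w_def power2_norm_eq_inner)
  moreover have "0 \<le> bregman f w y"
    by (rule bregman_nonneg[OF conv diff])
  ultimately have "(norm d)\<^sup>2 / L - (norm d)\<^sup>2 / (2 * L) \<le> bregman f x y"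
    using 1 by simp
  thus ?thesis using L by (simp add: d_def field_simps)
qed

section \<open>Minimising a convex function plus a squared distance\<close>

text \<open>A finite convex function is continuous, hence bounded on the unit ball around \<open>y\<close>. A point
  farther away is joined to \<open>y\<close> by a segment that crosses the unit sphere, where the lower bound
  propagates linearly outwards by convexity. This is the coercivity that the
  existence of proximal points needs.\<close>

lemma convex_on_affine_growth:
  fixes h :: "'a::euclidean_space \<Rightarrow> real"
  assumes conv: "convex_on UNIV h"
  obtains K where "K \<ge> 0" "\<And>u. norm (u - y) \<ge> 1 \<Longrightarrow> h u \<ge> h y - K * norm (u - y)"
proof -
  have cont: "continuous_on UNIV h"
    by (rule convex_on_continuous[OF _ conv]) simp
  have "bounded (h ` cball y 1)"
    by (intro compact_imp_bounded compact_continuous_image continuous_on_subset[OF cont]) auto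
  then obtain M where M: "\<And>v. v \<in> cball y 1 \<Longrightarrow> \<bar>h v\<bar> \<le> M"
    unfolding bounded_iff by fastforce
  show thesis
  proof
    have "0 \<le> M" using M[of y] by simp
    thus "0 \<le> M + \<bar>h y\<bar>" by simp
    fix u assume r1: "norm (u - y) \<ge> 1"
    define r where "r = norm (u - y)"
    define v where "v = (1 - 1 / r) *\<^sub>R y + (1 / r) *\<^sub>R u"
    have r: "r \<ge> 1" using r1 by (simp add: r_def)
    have "v - y = (1 / r) *\<^sub>R (u - y)" by (simp add: v_def algebra_simps)
    hence "norm (v - y) = 1" using r by (auto simp: r_def)
    hence "v \<in> cball y 1" by (simp add: dist_norm norm_minus_commute)
    hence "- M \<le> h v" using M by fastforce
    also have "h v \<le> (1 - 1 / r) * h y + (1 / r) * h u"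
      unfolding v_def by (rule convex_onD[OF conv]) (use r in auto)
    finally have "- M * r \<le> ((1 - 1 / r) * h y + (1 / r) * h u) * r"
      using r by (intro mult_right_mono) auto
    also have "\<dots> = r * h y - h y + h u"
    proof -
      have "r \<noteq> 0" using r by linarith
      thus ?thesis by (simp add: left_diff_distrib distrib_right)
    qed
    finally have "h u \<ge> h y - (M + h y) * r" by (simp add: algebra_simps)
    moreover have "(M + h y) * r \<le> (M + \<bar>h y\<bar>) * r" using r by (intro mult_right_mono) auto
    ultimately show "h u \<ge> h y - (M + \<bar>h y\<bar>) * norm (u - y)" unfolding r_def by linarith
  qed
qed

text \<open>Beyond the radius \<open>max 1 (K / c)\<close> the quadratic term outweighs the linear descent rate \<open>K\<close>, so a
  minimiser over the ball of that radius is global.\<close>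

lemma convex_plus_sqdist_attains_min:
  fixes h :: "'a::euclidean_space \<Rightarrow> real"
  assumes conv: "convex_on UNIV h" and c: "c > 0"
  shows "\<exists>z. \<forall>u. h z + c * (norm (z - y))\<^sup>2 \<le> h u + c * (norm (u - y))\<^sup>2"
proof -
  let ?H = "\<lambda>u. h u + c * (norm (u - y))\<^sup>2"
  obtain K where K: "K \<ge> 0" "\<And>u. norm (u - y) \<ge> 1 \<Longrightarrow> h u \<ge> h y - K * norm (u - y)"
    using convex_on_affine_growth[OF conv, of y] by blast
  define r where "r = max 1 (K / c)"
  have "continuous_on (cball y r) ?H"
    by (intro continuous_intros continuous_on_subset[OF convex_on_continuous[OF _ conv]]) auto
  moreover have "y \<in> cball y r" by (simp add: r_def)
  ultimately obtain z where z: "\<And>u. u \<in> cball y r \<Longrightarrow> ?H z \<le> ?H u"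
    using continuous_attains_inf[of "cball y r" ?H] by fastforce
  have "?H z \<le> ?H u" for u
  proof (cases "u \<in> cball y r")
    case False
    hence "norm (u - y) > r" by (simp add: dist_norm norm_minus_commute)
    hence "norm (u - y) \<ge> 1" "c * norm (u - y) \<ge> K"
      using c by (auto simp: r_def field_simps)
    hence "K * norm (u - y) \<le> c * norm (u - y) * norm (u - y)"
      by (intro mult_right_mono) auto
    hence "?H y \<le> ?H u"
      using K(2)[OF \<open>norm (u - y) \<ge> 1\<close>] by (simp add: power2_eq_square algebra_simps)
    thus ?thesis using z[OF \<open>y \<in> cball y r\<close>] by linarith
  qed (rule z)
  thus ?thesis by blast
qed

lemma norm_sq_segment:
  fixes u v :: "'a::real_inner"
  shows "(norm ((1 - t) *\<^sub>R u + t *\<^sub>R v))\<^sup>2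
    = (1 - t) * (norm u)\<^sup>2 + t * (norm v)\<^sup>2 - t * (1 - t) * (norm (u - v))\<^sup>2"
  unfolding power2_norm_eq_inner
  by (simp add: inner_add_left inner_add_right inner_diff_left inner_diff_right
      inner_commute[of v u] algebra_simps power2_eq_square)

text \<open>Moving a fraction \<open>t\<close> of the way from the minimiser towards \<open>w\<close> cannot decrease the
  function, while strong convexity makes it gain \<open>t * (1 - t) * c\<close> times the squared distance
  over the chord; divide by \<open>t\<close> and let \<open>t\<close> tend to \<open>0\<close>.\<close>

lemma convex_plus_sqdist_quadratic_growth:
  fixes h :: "'a::real_inner \<Rightarrow> real"
  assumes conv: "convex_on UNIV h"
    and min: "\<And>u. h z + c * (norm (z - y))\<^sup>2 \<le> h u + c * (norm (u - y))\<^sup>2"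
  shows "h z + c * (norm (z - y))\<^sup>2 + c * (norm (w - z))\<^sup>2 \<le> h w + c * (norm (w - y))\<^sup>2"
proof (rule le_of_le_add_vanishing[where c = "c * (norm (w - z))\<^sup>2"])
  fix t :: real assume t: "0 < t" "t < 1"
  let ?H = "\<lambda>u. h u + c * (norm (u - y))\<^sup>2"
  let ?v = "(1 - t) *\<^sub>R z + t *\<^sub>R w"
  have "h ?v \<le> (1 - t) * h z + t * h w"
    using t by (intro convex_onD[OF conv]) auto
  moreover
  have "(norm (?v - y))\<^sup>2 = (1 - t) * (norm (z - y))\<^sup>2 + t * (norm (w - y))\<^sup>2
      - t * (1 - t) * (norm (w - z))\<^sup>2"
  proof -
    have "?v - y = (1 - t) *\<^sub>R (z - y) + t *\<^sub>R (w - y)" by (simp add: algebra_simps)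
    thus ?thesis using norm_sq_segment[of t "z - y" "w - y"] by (simp add: norm_minus_commute)
  qed
  hence "c * (norm (?v - y))\<^sup>2 = c * ((1 - t) * (norm (z - y))\<^sup>2 + t * (norm (w - y))\<^sup>2
      - t * (1 - t) * (norm (w - z))\<^sup>2)" by simp
  ultimately have "?H ?v \<le> (1 - t) * ?H z + t * ?H w - t * (1 - t) * c * (norm (w - z))\<^sup>2"
    by argo
  hence "?H z \<le> (1 - t) * ?H z + t * ?H w - t * (1 - t) * c * (norm (w - z))\<^sup>2"
    using min[of ?v] by linarith
  hence "t * (?H z + c * (norm (w - z))\<^sup>2) \<le> t * (?H w + t * (c * (norm (w - z))\<^sup>2))"
    by (simp add: algebra_simps)
  thus "h z + c * (norm (z - y))\<^sup>2 + c * (norm (w - z))\<^sup>2 \<le> h w + c * (norm (w - y))\<^sup>2 + t * (c * (norm (w - z))\<^sup>2)"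
    using t by simp
qed

section \<open>Expectations over finitely supported distributions\<close>

lemma expectation_bind_finite:
  fixes h :: "'b \<Rightarrow> 'c::{banach, second_countable_topology}"
  assumes "finite (set_pmf p)" "\<And>x. x \<in> set_pmf p \<Longrightarrow> finite (set_pmf (f x))"
  shows "measure_pmf.expectation (bind_pmf p f) h
    = measure_pmf.expectation p (\<lambda>x. measure_pmf.expectation (f x) h)"
  using assms
  by (simp add: pmf_expectation_bind[of "set_pmf p"] integral_measure_pmf[of "set_pmf p"])

lemma expectation_mono_finite:
  fixes g h :: "'a \<Rightarrow> real"
  assumes "finite (set_pmf p)" "\<And>x. x \<in> set_pmf p \<Longrightarrow> g x \<le> h x"
  shows "measure_pmf.expectation p g \<le> measure_pmf.expectation p h"
  using assms
  by (intro integral_mono_AE) (auto simp: AE_measure_pmf_iff intro: integrable_measure_pmf_finite)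

text \<open>The form in which every potential is propagated: if each possible state \<open>x\<close> is followed
  by a conditional expectation of at most \<open>g x + c\<close>, the unconditional expectation grows by at
  most \<open>c\<close>.\<close>

lemma expectation_bind_le:
  fixes h :: "'b \<Rightarrow> real"
  assumes "finite (set_pmf p)" "\<And>x. x \<in> set_pmf p \<Longrightarrow> finite (set_pmf (f x))"
    and "\<And>x. x \<in> set_pmf p \<Longrightarrow> measure_pmf.expectation (f x) h \<le> g x + c"
  shows "measure_pmf.expectation (bind_pmf p f) h \<le> measure_pmf.expectation p g + c"
proof -
  have "measure_pmf.expectation (bind_pmf p f) h \<le> measure_pmf.expectation p (\<lambda>x. g x + c)"
    using assms by (simp add: expectation_bind_finite expectation_mono_finite)
  also have "\<dots> = measure_pmf.expectation p g + c"
    using assms(1) by (simp add: integrable_measure_pmf_finite)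
  finally show ?thesis .
qed

lemma finite_set_replicate_pmf:
  assumes "finite (set_pmf p)"
  shows "finite (set_pmf (replicate_pmf b p))"
  by (rule finite_subset[OF _ finite_lists_length_eq[OF assms, of b]])
    (auto simp: set_replicate_pmf)

lemma expectation_replicate_Suc:
  fixes h :: "'b list \<Rightarrow> 'c::{banach, second_countable_topology}"
  assumes "finite (set_pmf p)"
  shows "measure_pmf.expectation (replicate_pmf (Suc b) p) h
    = measure_pmf.expectation p
        (\<lambda>x. measure_pmf.expectation (replicate_pmf b p) (\<lambda>xs. h (x # xs)))"
  using assms by (simp add: expectation_bind_finite finite_set_replicate_pmf)

lemma expectation_minibatch_sum:
  fixes X :: "'b \<Rightarrow> 'a::euclidean_space"
  assumes fin: "finite (set_pmf p)" and mean: "measure_pmf.expectation p X = 0"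
  shows "measure_pmf.expectation (replicate_pmf b p) (\<lambda>xs. \<Sum>x\<leftarrow>xs. X x) = 0"
proof (induction b)
  case (Suc b)
  note int = integrable_measure_pmf_finite[OF fin]
    integrable_measure_pmf_finite[OF finite_set_replicate_pmf[OF fin]]
  show ?case
    unfolding expectation_replicate_Suc[OF fin] using Suc mean by (simp add: int)
qed simp

text \<open>Independent centred vectors are uncorrelated, so their second moments add up.\<close>

lemma expectation_minibatch_sum_norm_sq:
  fixes X :: "'b \<Rightarrow> 'a::euclidean_space"
  assumes fin: "finite (set_pmf p)" and mean: "measure_pmf.expectation p X = 0"
  shows "measure_pmf.expectation (replicate_pmf b p) (\<lambda>xs. (norm (\<Sum>x\<leftarrow>xs. X x))\<^sup>2)
    = real b * measure_pmf.expectation p (\<lambda>x. (norm (X x))\<^sup>2)"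
proof (induction b)
  case (Suc b)
  note int = integrable_measure_pmf_finite[OF fin]
    integrable_measure_pmf_finite[OF finite_set_replicate_pmf[OF fin]]
  have sq: "(norm (u + v))\<^sup>2 = (norm u)\<^sup>2 + 2 * inner u v + (norm v)\<^sup>2" for u v :: 'a
    by (simp add: power2_norm_eq_inner inner_add_left inner_add_right inner_commute)
  show ?case
    unfolding expectation_replicate_Suc[OF fin]
    using Suc expectation_minibatch_sum[OF assms, of b]
    by (simp add: int sq algebra_simps)
qed simp

lemma expectation_centred_norm_sq_le:
  fixes X :: "'b \<Rightarrow> 'a::euclidean_space"
  assumes fin: "finite (set_pmf p)" and mean: "measure_pmf.expectation p X = \<mu>"
  shows "measure_pmf.expectation p (\<lambda>x. (norm (X x - \<mu>))\<^sup>2)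
    \<le> measure_pmf.expectation p (\<lambda>x. (norm (X x))\<^sup>2)"
proof -
  note int = integrable_measure_pmf_finite[OF fin]
  have sq: "(norm (u - \<mu>))\<^sup>2 = (norm u)\<^sup>2 - 2 * inner \<mu> u + (norm \<mu>)\<^sup>2" for u
    by (simp add: power2_norm_eq_inner inner_diff_left inner_diff_right inner_commute)
  have "measure_pmf.expectation p (\<lambda>x. (norm (X x - \<mu>))\<^sup>2)
      = measure_pmf.expectation p (\<lambda>x. (norm (X x))\<^sup>2) - (norm \<mu>)\<^sup>2"
    using mean by (simp add: int sq) (simp add: power2_norm_eq_inner)
  thus ?thesis by simp
qed

section \<open>The composite problem and its gradient estimates\<close>

locale composite_problem =
  fixes n :: nat and f :: "nat \<Rightarrow> 'a::euclidean_space \<Rightarrow> real" and R :: "'a \<Rightarrow> real"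
    and L :: "nat \<Rightarrow> real" and xstar :: 'a
  assumes n_pos: "n \<ge> 1"
    and f_convex: "\<And>i. i \<in> {1..n} \<Longrightarrow> convex_on UNIV (f i)"
    and f_differentiable: "\<And>i x. i \<in> {1..n} \<Longrightarrow> f i differentiable (at x)"
    and L_pos: "\<And>i. i \<in> {1..n} \<Longrightarrow> L i > 0"
    and f_smooth: "\<And>i x y. i \<in> {1..n} \<Longrightarrow>
      norm (gradient (f i) x - gradient (f i) y) \<le> L i * norm (x - y)"
    and R_convex: "convex_on UNIV R"
    and xstar_min: "\<And>x. average n f xstar + R xstar \<le> average n f x + R x"
begin

abbreviation F :: "'a \<Rightarrow> real" where "F \<equiv> average n f"
abbreviation Lbar :: real where "Lbar \<equiv> mean_smoothness n L"
abbreviation Q :: "nat pmf" where "Q \<equiv> sampling_pmf n L"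

definition P :: "'a \<Rightarrow> real" where "P x = F x + R x"

lemma n_real_pos: "real n > 0" using n_pos by simp

lemma sum_L_pos: "(\<Sum>i = 1..n. L i) > 0"
  using n_pos L_pos by (intro sum_pos) auto

lemma Lbar_pos: "Lbar > 0"
  using n_real_pos sum_L_pos by (simp add: mean_smoothness_def)

lemma GDERIV_F: "GDERIV F x :> (1 / real n) *\<^sub>R (\<Sum>i = 1..n. gradient (f i) x)"
proof -
  have "((\<lambda>x. (1 / real n) * (\<Sum>i = 1..n. f i x)) has_derivative
      (\<lambda>h. (1 / real n) * (\<Sum>i = 1..n. inner h (gradient (f i) x)))) (at x)"
    using GDERIV_gradient[OF f_differentiable, unfolded gderiv_def]
    by (intro has_derivative_mult_right has_derivative_sum) auto
  thus ?thesis
    unfolding gderiv_def average_def by (simp add: inner_sum_right)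
qed

lemma gradient_F: "gradient F x = (1 / real n) *\<^sub>R (\<Sum>i = 1..n. gradient (f i) x)"
  by (rule gradient_eqI[OF GDERIV_F])

lemma bregman_F: "bregman F x y = (1 / real n) * (\<Sum>i = 1..n. bregman (f i) x y)"
  by (simp add: bregman_def gradient_F average_def inner_sum_left sum_subtractf right_diff_distrib)

lemma bregman_F_nonneg: "0 \<le> bregman F x y"
  unfolding bregman_F
  by (intro mult_nonneg_nonneg sum_nonneg bregman_nonneg f_convex f_differentiable) auto

lemma bregman_F_le: "bregman F x y \<le> Lbar / 2 * (norm (x - y))\<^sup>2"
proof -
  have "(\<Sum>i = 1..n. bregman (f i) x y) \<le> (\<Sum>i = 1..n. L i / 2 * (norm (x - y))\<^sup>2)"
    by (intro sum_mono bregman_le_of_lipschitz_gradient f_differentiable f_smooth) auto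
  also have "\<dots> = (\<Sum>i = 1..n. L i) / 2 * (norm (x - y))\<^sup>2"
    by (simp add: sum_distrib_right sum_divide_distrib)
  finally show ?thesis
    unfolding bregman_F mean_smoothness_def using n_real_pos by (simp add: field_simps)
qed

lemma tangent_le_F: "F y + inner (gradient F y) (x - y) \<le> F x"
  using bregman_F_nonneg[of x y] by (simp add: bregman_def)

text \<open>Optimality of the minimiser is the inclusion of minus the gradient of \<open>F\<close> in the
  subdifferential of \<open>R\<close>. It is derived here by comparing \<open>xstar\<close> with points at distance
  proportional to \<open>t\<close>, where \<open>F\<close> is affine up to order \<open>t\<close> squared.\<close>

lemma bregman_minimizer_le: "bregman F w xstar \<le> P w - P xstar"
proof -
  define d where "d = w - xstar"
  have "R xstar - R w \<le> inner (gradient F xstar) d"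
  proof (rule le_of_le_add_vanishing[where c = "Lbar / 2 * (norm d)\<^sup>2"])
    fix t :: real assume t: "0 < t" "t < 1"
    have seg: "(1 - t) *\<^sub>R xstar + t *\<^sub>R w = xstar + t *\<^sub>R d"
      by (simp add: d_def algebra_simps)
    have "R (xstar + t *\<^sub>R d) \<le> (1 - t) * R xstar + t * R w"
      using convex_onD[OF R_convex, of t xstar w] t by (simp add: seg)
    moreover have "bregman F (xstar + t *\<^sub>R d) xstar \<le> t * t * (Lbar / 2 * (norm d)\<^sup>2)"
      using bregman_F_le[of "xstar + t *\<^sub>R d" xstar] t
      by (simp add: power_mult_distrib power2_eq_square ac_simps)
    moreover have "F xstar + R xstar \<le> F (xstar + t *\<^sub>R d) + R (xstar + t *\<^sub>R d)"
      by (rule xstar_min)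
    ultimately have "t * (R xstar - R w)
        \<le> t * (inner (gradient F xstar) d + t * (Lbar / 2 * (norm d)\<^sup>2))"
      by (simp add: bregman_def algebra_simps)
    thus "R xstar - R w \<le> inner (gradient F xstar) d + t * (Lbar / 2 * (norm d)\<^sup>2)"
      using t by simp
  qed
  thus ?thesis by (simp add: bregman_def P_def d_def)
qed

text \<open>Up to the factor \<open>2 * Lbar / b\<close> this bounds the variance of a minibatch gradient estimate at
  \<open>y\<close> with snapshot \<open>x\<close>. Each component is weighted by \<open>1 / (2 * L i)\<close> so that cocoercivity of the
  gradients applies term by term.\<close>

definition gradient_gap :: "'a \<Rightarrow> 'a \<Rightarrow> real" where
  "gradient_gap x y =
     (1 / real n) * (\<Sum>i = 1..n. (norm (gradient (f i) x - gradient (f i) y))\<^sup>2 / (2 * L i))"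

lemma gradient_gap_le_bregman: "gradient_gap x y \<le> bregman F x y"
  unfolding gradient_gap_def bregman_F
  by (intro mult_left_mono sum_mono norm_gradient_diff_le_bregman f_convex f_differentiable
      L_pos f_smooth) auto

lemma gradient_gap_triangle: "gradient_gap x y \<le> 2 * (gradient_gap w y + gradient_gap x w)"
proof -
  have sq: "(norm (a - b))\<^sup>2 \<le> 2 * ((norm (c - b))\<^sup>2 + (norm (a - c))\<^sup>2)" for a b c :: 'a
  proof -
    have "(norm (a - b))\<^sup>2 \<le> (norm (c - b) + norm (a - c))\<^sup>2"
      using norm_triangle_ineq[of "c - b" "a - c"] by (intro power_mono) auto
    also have "\<dots> \<le> 2 * ((norm (c - b))\<^sup>2 + (norm (a - c))\<^sup>2)"
      using sum_squares_bound[of "norm (c - b)" "norm (a - c)"] by (simp add: power2_sum)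
    finally show ?thesis .
  qed
  have "(\<Sum>i = 1..n. (norm (gradient (f i) x - gradient (f i) y))\<^sup>2 / (2 * L i))
      \<le> (\<Sum>i = 1..n. 2 * ((norm (gradient (f i) w - gradient (f i) y))\<^sup>2
          + (norm (gradient (f i) x - gradient (f i) w))\<^sup>2) / (2 * L i))"
    using L_pos by (intro sum_mono divide_right_mono sq) (auto intro: less_imp_le)
  also have "\<dots> = 2 * ((\<Sum>i = 1..n. (norm (gradient (f i) w - gradient (f i) y))\<^sup>2 / (2 * L i))
      + (\<Sum>i = 1..n. (norm (gradient (f i) x - gradient (f i) w))\<^sup>2 / (2 * L i)))"
    by (simp add: sum.distrib sum_distrib_left add_divide_distrib distrib_left)
  finally have "(1 / real n) * (\<Sum>i = 1..n. (norm (gradient (f i) x - gradient (f i) y))\<^sup>2 / (2 * L i))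
      \<le> (1 / real n) * (2 * ((\<Sum>i = 1..n. (norm (gradient (f i) w - gradient (f i) y))\<^sup>2 / (2 * L i))
      + (\<Sum>i = 1..n. (norm (gradient (f i) x - gradient (f i) w))\<^sup>2 / (2 * L i))))"
    by (intro mult_left_mono) auto
  thus ?thesis
    unfolding gradient_gap_def by (simp add: algebra_simps)
qed

text \<open>Unlike \<open>gradient_gap_le_bregman\<close>, this bound avoids the divergence of \<open>x\<close> from \<open>y\<close>. It
  serves the first stage, where the weight of the snapshot in the reference point may vanish.\<close>

lemma gradient_gap_le_via_minimizer:
  "gradient_gap x y \<le> 2 * (bregman F xstar y + (P x - P xstar))"
  using gradient_gap_triangle[of x y xstar] gradient_gap_le_bregman[of xstar y]
    gradient_gap_le_bregman[of x xstar] bregman_minimizer_le[of x] by simp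

lemma pmf_Q: "i \<in> {1..n} \<Longrightarrow> pmf Q i = L i / (real n * Lbar)"
  using pmf_sampling_pmf[OF n_pos L_pos, where i = i] by simp

lemma set_pmf_Q: "set_pmf Q \<subseteq> {1..n}"
proof
  fix i assume "i \<in> set_pmf Q"
  hence "pmf Q i \<noteq> 0" by (simp add: set_pmf_iff)
  thus "i \<in> {1..n}"
    using pmf_sampling_pmf[OF n_pos L_pos, where i = i] by (auto split: if_splits)
qed

lemma finite_set_pmf_Q: "finite (set_pmf Q)"
  by (rule finite_subset[OF set_pmf_Q]) simp

lemma expectation_Q:
  fixes h :: "nat \<Rightarrow> 'c::{banach, second_countable_topology}"
  shows "measure_pmf.expectation Q h = (\<Sum>i = 1..n. (L i / (real n * Lbar)) *\<^sub>R h i)"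
proof -
  have "measure_pmf.expectation Q h = (\<Sum>i = 1..n. pmf Q i *\<^sub>R h i)"
    using set_pmf_Q by (intro integral_measure_pmf) auto
  also have "\<dots> = (\<Sum>i = 1..n. (L i / (real n * Lbar)) *\<^sub>R h i)"
    by (intro sum.cong) (simp_all only: pmf_Q)
  finally show ?thesis .
qed

definition scaled_gradient_diff :: "'a \<Rightarrow> 'a \<Rightarrow> nat \<Rightarrow> 'a" where
  "scaled_gradient_diff xt y i =
     (1 / (real n * pmf Q i)) *\<^sub>R (gradient (f i) y - gradient (f i) xt)"

lemma expectation_scaled_gradient_diff:
  "measure_pmf.expectation Q (scaled_gradient_diff xt y) = gradient F y - gradient F xt"
proof -
  have "(L i / (real n * Lbar)) *\<^sub>R scaled_gradient_diff xt y i
      = (1 / real n) *\<^sub>R (gradient (f i) y - gradient (f i) xt)" if "i \<in> {1..n}" for i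
    using L_pos[OF that] Lbar_pos n_real_pos by (simp add: scaled_gradient_diff_def pmf_Q[OF that])
  hence "measure_pmf.expectation Q (scaled_gradient_diff xt y)
      = (\<Sum>i = 1..n. (1 / real n) *\<^sub>R (gradient (f i) y - gradient (f i) xt))"
    unfolding expectation_Q by (intro sum.cong) auto
  thus ?thesis
    by (simp add: gradient_F scaleR_diff_right sum_subtractf scaleR_sum_right)
qed

text \<open>Sampling proportionally to \<open>L i\<close> makes the second moment of the estimate a multiple of a
  single quantity with the mean constant \<open>Lbar\<close> in front.\<close>

lemma expectation_scaled_gradient_diff_norm_sq:
  "measure_pmf.expectation Q (\<lambda>i. (norm (scaled_gradient_diff xt y i))\<^sup>2)
    = 2 * Lbar * gradient_gap xt y"
proof -
  have "(L i / (real n * Lbar)) *\<^sub>R (norm (scaled_gradient_diff xt y i))\<^sup>2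
      = 2 * Lbar * (1 / real n)
        * ((norm (gradient (f i) xt - gradient (f i) y))\<^sup>2 / (2 * L i))" if "i \<in> {1..n}" for i
  proof -
    have "scaled_gradient_diff xt y i = (Lbar / L i) *\<^sub>R (gradient (f i) y - gradient (f i) xt)"
      using n_real_pos by (simp add: scaled_gradient_diff_def pmf_Q[OF that])
    thus ?thesis
      using L_pos[OF that] Lbar_pos n_real_pos
      by (simp add: norm_minus_commute power_mult_distrib power_divide power2_eq_square del: scaleR_diff_right)
  qed
  hence "measure_pmf.expectation Q (\<lambda>i. (norm (scaled_gradient_diff xt y i))\<^sup>2)
      = (\<Sum>i = 1..n. 2 * Lbar * (1 / real n)
        * ((norm (gradient (f i) xt - gradient (f i) y))\<^sup>2 / (2 * L i)))"
    unfolding expectation_Q by (intro sum.cong) auto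
  thus ?thesis
    by (simp add: gradient_gap_def sum_distrib_left mult.assoc)
qed

lemma svrg_estimate_error:
  assumes "b \<ge> 1" "length I = b"
  shows "svrg_estimate n f b Q xt I y - gradient F y
    = (1 / real b) *\<^sub>R (\<Sum>i\<leftarrow>I. scaled_gradient_diff xt y i - (gradient F y - gradient F xt))"
proof -
  have "(\<Sum>i\<leftarrow>J. X i - c) = (\<Sum>i\<leftarrow>J. X i) - real (length J) *\<^sub>R c"
    for J :: "nat list" and X and c :: 'a
    by (induction J) (simp_all add: algebra_simps)
  note centre = this
  show ?thesis
    using assms
    by (simp add: centre svrg_estimate_def scaled_gradient_diff_def[abs_def] scaleR_diff_right[of "1 / real b"])
qed

lemma finite_set_minibatch: "finite (set_pmf (replicate_pmf b Q))"
  by (rule finite_set_replicate_pmf[OF finite_set_pmf_Q])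

lemma minibatch_length: "I \<in> set_pmf (replicate_pmf b Q) \<Longrightarrow> length I = b"
  by (simp add: set_replicate_pmf)

lemma expectation_Q_centred:
  "measure_pmf.expectation Q
     (\<lambda>i. scaled_gradient_diff xt y i - (gradient F y - gradient F xt)) = 0"
  by (simp add: expectation_scaled_gradient_diff integrable_measure_pmf_finite[OF finite_set_pmf_Q])

lemma svrg_estimate_unbiased:
  assumes "b \<ge> 1"
  shows "measure_pmf.expectation (replicate_pmf b Q)
    (\<lambda>I. svrg_estimate n f b Q xt I y - gradient F y) = 0"
proof -
  have "measure_pmf.expectation (replicate_pmf b Q)
      (\<lambda>I. svrg_estimate n f b Q xt I y - gradient F y)
    = measure_pmf.expectation (replicate_pmf b Q) (\<lambda>I. (1 / real b) *\<^sub>R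
        (\<Sum>i\<leftarrow>I. scaled_gradient_diff xt y i - (gradient F y - gradient F xt)))"
    by (intro integral_cong_AE)
      (auto simp: AE_measure_pmf_iff minibatch_length intro!: svrg_estimate_error assms)
  thus ?thesis
    by (simp add: integrable_measure_pmf_finite[OF finite_set_minibatch]
        expectation_minibatch_sum[OF finite_set_pmf_Q expectation_Q_centred])
qed

lemma svrg_estimate_variance:
  assumes "b \<ge> 1"
  shows "measure_pmf.expectation (replicate_pmf b Q)
      (\<lambda>I. (norm (svrg_estimate n f b Q xt I y - gradient F y))\<^sup>2)
    \<le> 2 * Lbar / real b * gradient_gap xt y"
proof -
  let ?Y = "\<lambda>i. scaled_gradient_diff xt y i - (gradient F y - gradient F xt)"
  have "measure_pmf.expectation (replicate_pmf b Q)
      (\<lambda>I. (norm (svrg_estimate n f b Q xt I y - gradient F y))\<^sup>2)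
    = measure_pmf.expectation (replicate_pmf b Q)
        (\<lambda>I. (1 / real b)\<^sup>2 * (norm (\<Sum>i\<leftarrow>I. ?Y i))\<^sup>2)"
    by (intro integral_cong_AE)
      (auto simp: AE_measure_pmf_iff minibatch_length svrg_estimate_error[OF assms] power_divide)
  also have "\<dots> = (1 / real b)\<^sup>2 * (real b * measure_pmf.expectation Q (\<lambda>i. (norm (?Y i))\<^sup>2))"
    by (simp add: expectation_minibatch_sum_norm_sq[OF finite_set_pmf_Q expectation_Q_centred])
  also have "\<dots> \<le> (1 / real b)\<^sup>2 * (real b * (2 * Lbar * gradient_gap xt y))"
    unfolding expectation_scaled_gradient_diff_norm_sq[symmetric]
    by (intro mult_left_mono expectation_centred_norm_sq_le finite_set_pmf_Q
        expectation_scaled_gradient_diff) auto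
  also have "\<dots> = 2 * Lbar / real b * gradient_gap xt y"
    using assms by (simp add: power2_eq_square)
  finally show ?thesis .
qed

end

section \<open>One stage of accelerated dual averaging\<close>

text \<open>The product of consecutive momentum parameters \<open>theta k * theta (k - 1)\<close> for \<open>k \<ge> 1\<close>.
  At \<open>k = 0\<close> it must be \<open>0\<close>, the weight of an empty sum of gradients, whereas truncated
  subtraction would make the product \<open>1 / 4\<close>.\<close>

definition weight :: "nat \<Rightarrow> real" where
  "weight k = real k * (real k + 1) / 4"

lemma weight_Suc: "weight (Suc k) = weight k + (real k + 1) / 2"
  by (simp add: weight_def field_simps)

lemma weight_Suc_theta:
  "weight (Suc k) * (1 / theta (Suc k)) = (real k + 1) / 2"
  "weight (Suc k) * (1 - 1 / theta (Suc k)) = weight k"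
  by (simp_all add: weight_def theta_def field_simps)

lemma weight_pos: "k \<ge> 1 \<Longrightarrow> weight k > 0"
  by (simp add: weight_def)

context composite_problem
begin

text \<open>\<open>weight k\<close> times the function minimised at step \<open>k\<close>. With this scaling consecutive models
  differ by the contribution of the newest gradient estimate alone, and the model at \<open>k = 0\<close> is the
  proximal term.\<close>

definition dual_model :: "real \<Rightarrow> 'a \<Rightarrow> nat \<Rightarrow> 'a \<Rightarrow> 'a \<Rightarrow> real" where
  "dual_model \<eta> yt k g w = weight k * (inner g w + R w) + (norm (w - yt))\<^sup>2 / (2 * \<eta>)"

text \<open>The state carries its running gradient average, so minimality of \<open>z\<close> can be stated as a
  property of the state. Strong convexity is included as quadratic growth.\<close>

definition minimizes_dual_model :: "real \<Rightarrow> 'a \<Rightarrow> nat \<Rightarrow> 'a \<times> 'a \<times> 'a \<Rightarrow> bool" where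
  "minimizes_dual_model \<eta> yt k = (\<lambda>(x, z, g).
     \<forall>w. dual_model \<eta> yt k g z + (norm (w - z))\<^sup>2 / (2 * \<eta>) \<le> dual_model \<eta> yt k g w)"

definition stage_potential :: "real \<Rightarrow> 'a \<Rightarrow> 'a \<Rightarrow> nat \<Rightarrow> 'a \<times> 'a \<times> 'a \<Rightarrow> real" where
  "stage_potential \<eta> yt u k = (\<lambda>(x, z, g).
     weight k * P x + dual_model \<eta> yt k g u - dual_model \<eta> yt k g z)"

lemma convex_on_linear_plus_R:
  assumes "a \<ge> 0"
  shows "convex_on UNIV (\<lambda>w. a * (inner g w + R w))"
proof (intro convex_on_cmul[OF assms] convex_on_add R_convex)
  show "convex_on UNIV (inner g)"
    by (rule convex_onI) (simp_all add: inner_add_right)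
qed

lemma accsvrda_step_minimizes:
  assumes "\<eta> > 0"
  shows "minimizes_dual_model \<eta> yt (Suc k) (accsvrda_step n f R yt xt \<eta> b Q (Suc k) I st)"
proof -
  obtain x z gbar where st: "st = (x, z, gbar)" by (cases st)
  define t where "t = 1 / theta (Suc k)"
  define y where "y = (1 - t) *\<^sub>R x + t *\<^sub>R z"
  define g where "g = (1 - t) *\<^sub>R gbar + t *\<^sub>R svrg_estimate n f b Q xt I y"
  define H where "H u = inner g u + R u
      + 1 / (2 * \<eta> * theta (Suc k) * theta k) * (norm (u - yt))\<^sup>2" for u
  define z' where "z' = arg_min H (\<lambda>_. True)"
  have step: "accsvrda_step n f R yt xt \<eta> b Q (Suc k) I st
      = ((1 - t) *\<^sub>R x + t *\<^sub>R z', z', g)"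
    unfolding accsvrda_step_def st z'_def H_def[abs_def] g_def y_def t_def
    by (simp add: Let_def)
  have W: "weight (Suc k) > 0" by (rule weight_pos) simp
  have tt: "theta (Suc k) * theta k = weight (Suc k)"
    by (simp add: theta_def weight_def field_simps)
  have H: "weight (Suc k) * H u = dual_model \<eta> yt (Suc k) g u" for u
    using W assms by (simp add: H_def dual_model_def tt mult.assoc distrib_left)
  define h where "h w = weight (Suc k) * (inner g w + R w)" for w
  have h: "convex_on UNIV h"
    unfolding h_def using W by (intro convex_on_linear_plus_R) simp
  have M: "dual_model \<eta> yt (Suc k) g u = h u + 1 / (2 * \<eta>) * (norm (u - yt))\<^sup>2" for u
    by (simp add: dual_model_def h_def)
  obtain v where "\<And>u. dual_model \<eta> yt (Suc k) g v \<le> dual_model \<eta> yt (Suc k) g u"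
    using convex_plus_sqdist_attains_min[OF h, of "1 / (2 * \<eta>)" yt] assms unfolding M by auto
  hence "H v \<le> H u" for u
    using W by (simp flip: H)
  hence "is_arg_min H (\<lambda>_. True) v" by (simp add: is_arg_min_linorder)
  hence "is_arg_min H (\<lambda>_. True) z'"
    unfolding z'_def arg_min_def by (rule someI)
  hence "H z' \<le> H u" for u by (simp add: is_arg_min_linorder)
  hence "dual_model \<eta> yt (Suc k) g z' \<le> dual_model \<eta> yt (Suc k) g u" for u
    using W by (simp flip: H)
  hence "h z' + 1 / (2 * \<eta>) * (norm (z' - yt))\<^sup>2 + 1 / (2 * \<eta>) * (norm (w - z'))\<^sup>2
      \<le> h w + 1 / (2 * \<eta>) * (norm (w - yt))\<^sup>2" for w
    unfolding M by (intro convex_plus_sqdist_quadratic_growth[OF h])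
  thus ?thesis unfolding step minimizes_dual_model_def by (simp add: M)
qed

text \<open>The pathwise inequality behind acceleration. \<open>F\<close> at the new point is bounded by its quadratic
  upper model at \<open>y\<close>, and the linear part splits between the old point, where it is below \<open>F\<close>, and
  the new prox point. The displacement \<open>z' - z\<close> thereby enters with coefficient \<open>Lbar / 2\<close>, while
  the quadratic growth of the old model supplies \<open>1 / (2 * \<eta>)\<close>. The difference \<open>\<kappa> / 2\<close>
  pays, by Young's inequality, for replacing the sample-dependent \<open>z'\<close> by \<open>z\<close> in the noise term:
  after that the noise is paired with a vector fixed before the sample is drawn.\<close>

lemma stage_potential_step:
  fixes x z gbar yt xt u :: 'a and k b :: nat
  defines "t \<equiv> 1 / theta (Suc k)"
  defines "y \<equiv> (1 - t) *\<^sub>R x + t *\<^sub>R z"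
  defines "\<delta> \<equiv> \<lambda>I. svrg_estimate n f b Q xt I y - gradient F y"
  assumes \<eta>: "\<eta> > 0" and \<kappa>: "1 / \<eta> - Lbar = \<kappa>" "\<kappa> > 0"
    and inv: "minimizes_dual_model \<eta> yt k (x, z, gbar)"
  shows "stage_potential \<eta> yt u (Suc k) (accsvrda_step n f R yt xt \<eta> b Q (Suc k) I (x, z, gbar))
    \<le> stage_potential \<eta> yt u k (x, z, gbar)
      + (real k + 1) / 2 * (F y + inner (gradient F y) (u - y) + R u)
      + (real k + 1) / 2 * inner (\<delta> I) (u - z)
      + ((real k + 1) / 2)\<^sup>2 / (2 * \<kappa>) * (norm (\<delta> I))\<^sup>2"
proof -
  define A a where "A = weight k" and "a = (real k + 1) / 2"
  define A' where "A' = weight (Suc k)"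
  define G where "G = svrg_estimate n f b Q xt I y"
  define g where "g = (1 - t) *\<^sub>R gbar + t *\<^sub>R G"
  define z' where "z' = arg_min (\<lambda>u. inner g u + R u
      + 1 / (2 * \<eta> * theta (Suc k) * theta k) * (norm (u - yt))\<^sup>2) (\<lambda>_. True)"
  define x' where "x' = (1 - t) *\<^sub>R x + t *\<^sub>R z'"
  have step: "accsvrda_step n f R yt xt \<eta> b Q (Suc k) I (x, z, gbar) = (x', z', g)"
    unfolding accsvrda_step_def x'_def z'_def g_def G_def y_def t_def by (simp add: Let_def)
  have A't: "A' * t = a" "A' * (1 - t) = A" and A': "A' > 0" and a: "a > 0"
    using weight_Suc_theta[of k] weight_pos[of "Suc k"]
    by (auto simp: A'_def A_def a_def t_def)
  have t01: "0 \<le> t" "t \<le> 1" by (simp_all add: t_def theta_def)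
  \<comment> \<open>\<open>a * t = (k + 1) / (k + 2)\<close>: the choice of \<open>theta\<close> keeps the curvature term below \<open>Lbar / 2\<close>.\<close>
  have at: "a * t \<le> 1"
    by (simp add: a_def t_def theta_def field_simps)
  have model: "dual_model \<eta> yt (Suc k) g w = dual_model \<eta> yt k gbar w + a * (inner G w + R w)" for w
  proof -
    have "A' * inner g w = (A' * (1 - t)) * inner gbar w + (A' * t) * inner G w"
      by (simp add: g_def inner_add_left algebra_simps)
    moreover have "A' = A + a" using A't by (simp add: algebra_simps)
    ultimately show ?thesis
      unfolding A't by (simp add: dual_model_def A'_def[symmetric] A_def[symmetric] algebra_simps)
  qed
  have F_x': "A' * F x' \<le> A * F x + a * (F y + inner (gradient F y) (z' - y))
      + Lbar / 2 * (norm (z' - z))\<^sup>2"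
  proof -
    have xy: "x' - y = t *\<^sub>R (z' - z)" by (simp add: x'_def y_def algebra_simps)
    have "bregman F x' y \<le> Lbar / 2 * (norm (x' - y))\<^sup>2" by (rule bregman_F_le)
    hence "A' * bregman F x' y \<le> A' * (Lbar / 2 * (norm (x' - y))\<^sup>2)"
      using A' by (intro mult_left_mono) auto
    also have "\<dots> = (A' * t * t) * (Lbar / 2 * (norm (z' - z))\<^sup>2)"
      by (simp add: xy power_mult_distrib power2_eq_square)
    also have "\<dots> \<le> 1 * (Lbar / 2 * (norm (z' - z))\<^sup>2)"
      unfolding A't using at Lbar_pos by (intro mult_right_mono) auto
    finally have 1: "A' * bregman F x' y \<le> Lbar / 2 * (norm (z' - z))\<^sup>2" by simp
    have split: "x' - y = (1 - t) *\<^sub>R (x - y) + t *\<^sub>R (z' - y)"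
      by (simp add: x'_def algebra_simps)
    have "F y + inner (gradient F y) (x' - y)
        = (1 - t) * (F y + inner (gradient F y) (x - y)) + t * (F y + inner (gradient F y) (z' - y))"
      by (simp only: split inner_add_right inner_scaleR_right) (simp add: algebra_simps)
    hence "A' * (F y + inner (gradient F y) (x' - y))
        = (A' * (1 - t)) * (F y + inner (gradient F y) (x - y))
          + (A' * t) * (F y + inner (gradient F y) (z' - y))"
      by (simp add: distrib_left)
    also have "\<dots> \<le> A * F x + a * (F y + inner (gradient F y) (z' - y))"
      unfolding A't by (intro add_mono mult_left_mono tangent_le_F)
        (use a in \<open>simp_all add: A_def weight_def\<close>)
    finally show ?thesis using 1 by (simp add: bregman_def algebra_simps)
  qed
  have R_x': "A' * R x' \<le> A * R x + a * R z'"
  proof -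
    have "A' * R x' \<le> A' * ((1 - t) * R x + t * R z')"
      unfolding x'_def using t01 A' by (intro mult_left_mono convex_onD[OF R_convex]) auto
    also have "\<dots> = A' * (1 - t) * R x + A' * t * R z'" by (simp add: distrib_left)
    finally show ?thesis unfolding A't .
  qed
  have growth: "dual_model \<eta> yt k gbar z + (norm (z' - z))\<^sup>2 / (2 * \<eta>) \<le> dual_model \<eta> yt k gbar z'"
    using inv unfolding minimizes_dual_model_def by simp
  have young: "a * inner (\<delta> I) (z - z') \<le> a\<^sup>2 / (2 * \<kappa>) * (norm (\<delta> I))\<^sup>2 + \<kappa> / 2 * (norm (z' - z))\<^sup>2"
  proof -
    have "a * inner (\<delta> I) (z - z') \<le> a * (norm (\<delta> I) * norm (z' - z))"
      using a norm_cauchy_schwarz[of "\<delta> I" "z - z'"]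
      by (intro mult_left_mono) (simp_all add: norm_minus_commute)
    also have "\<dots> \<le> a\<^sup>2 / (2 * \<kappa>) * (norm (\<delta> I))\<^sup>2 + \<kappa> / 2 * (norm (z' - z))\<^sup>2"
    proof -
      have "0 \<le> (a * norm (\<delta> I) - \<kappa> * norm (z' - z))\<^sup>2 / (2 * \<kappa>)" using \<kappa>(2) by simp
      also have "\<dots> = a\<^sup>2 / (2 * \<kappa>) * (norm (\<delta> I))\<^sup>2 + \<kappa> / 2 * (norm (z' - z))\<^sup>2
          - a * (norm (\<delta> I) * norm (z' - z))"
        using \<kappa>(2) by (simp add: power2_diff power_mult_distrib power2_eq_square field_simps)
      finally show ?thesis by simp
    qed
    finally show ?thesis .
  qed
  have G: "G = gradient F y + \<delta> I" by (simp add: G_def \<delta>_def)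
  have quad: "(norm (z' - z))\<^sup>2 / (2 * \<eta>)
      = Lbar / 2 * (norm (z' - z))\<^sup>2 + \<kappa> / 2 * (norm (z' - z))\<^sup>2"
    unfolding \<kappa>(1)[symmetric] by (simp add: left_diff_distrib diff_divide_distrib)
  have "stage_potential \<eta> yt u (Suc k) (x', z', g)
      = A' * F x' + A' * R x' + dual_model \<eta> yt k gbar u + a * (inner G u + R u)
        - dual_model \<eta> yt k gbar z' - a * (inner G z' + R z')"
    by (simp add: stage_potential_def model P_def A'_def distrib_left)
  also have "\<dots> \<le> (A * F x + a * (F y + inner (gradient F y) (z' - y)) + Lbar / 2 * (norm (z' - z))\<^sup>2)
        + (A * R x + a * R z') + dual_model \<eta> yt k gbar u + a * (inner G u + R u)
        - (dual_model \<eta> yt k gbar z + (norm (z' - z))\<^sup>2 / (2 * \<eta>)) - a * (inner G z' + R z')"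
    using F_x' R_x' growth by linarith
  also have "\<dots> = stage_potential \<eta> yt u k (x, z, gbar)
        + a * (F y + inner (gradient F y) (u - y) + R u) + a * inner (\<delta> I) (u - z)
        + a * inner (\<delta> I) (z - z') - \<kappa> / 2 * (norm (z' - z))\<^sup>2"
    unfolding quad G
    by (simp add: stage_potential_def P_def A_def inner_add_left inner_diff_right algebra_simps)
  finally show ?thesis
    using young unfolding step a_def by linarith
qed

text \<open>The step size makes \<open>\<kappa> = \<gamma> * (m + 1) / b * Lbar\<close>. The factors \<open>Lbar / b\<close> cancel
  against the variance bound, and the step weight \<open>(k + 1) / 2\<close> is at most half of \<open>m + 1\<close>, which
  leaves at most \<open>1 / (2 * \<gamma>)\<close>.\<close>

lemma stage_potential_expected_step:
  assumes b: "b \<ge> 1" and \<gamma>: "\<gamma> > 0" and \<eta>_def: "\<eta> = step_size n L \<gamma> m b" and k: "Suc k \<le> m"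
    and inv: "minimizes_dual_model \<eta> yt k st"
    and T: "\<And>y. F y + inner (gradient F y) (u - y) + R u + gradient_gap xt y / (2 * \<gamma>) \<le> T"
  shows "measure_pmf.expectation (replicate_pmf b Q)
      (\<lambda>I. stage_potential \<eta> yt u (Suc k) (accsvrda_step n f R yt xt \<eta> b Q (Suc k) I st))
    \<le> stage_potential \<eta> yt u k st + (real k + 1) / 2 * T"
proof -
  obtain x z gbar where st: "st = (x, z, gbar)" by (cases st)
  define t where "t = 1 / theta (Suc k)"
  define y where "y = (1 - t) *\<^sub>R x + t *\<^sub>R z"
  define \<delta> where "\<delta> I = svrg_estimate n f b Q xt I y - gradient F y" for I
  define \<kappa> where "\<kappa> = \<gamma> * (real m + 1) / real b * Lbar"
  define a where "a = (real k + 1) / 2"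
  define c where "c = stage_potential \<eta> yt u k st + a * (F y + inner (gradient F y) (u - y) + R u)"
  have \<eta>: "\<eta> > 0" and \<kappa>: "1 / \<eta> - Lbar = \<kappa>" "\<kappa> > 0"
    using b \<gamma> Lbar_pos
    by (simp_all add: \<eta>_def step_size_def \<kappa>_def distrib_right add_pos_pos)
  note int = integrable_measure_pmf_finite[OF finite_set_minibatch]
  have "measure_pmf.expectation (replicate_pmf b Q)
      (\<lambda>I. stage_potential \<eta> yt u (Suc k) (accsvrda_step n f R yt xt \<eta> b Q (Suc k) I st))
    \<le> measure_pmf.expectation (replicate_pmf b Q)
        (\<lambda>I. c + a * inner (u - z) (\<delta> I) + a\<^sup>2 / (2 * \<kappa>) * (norm (\<delta> I))\<^sup>2)"
    using stage_potential_step[OF \<eta> \<kappa> inv[unfolded st], where u = u and xt = xt and b = b]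
    by (intro expectation_mono_finite finite_set_minibatch)
      (simp add: st c_def a_def \<delta>_def y_def t_def inner_commute)
  also have "\<dots> = c + a\<^sup>2 / (2 * \<kappa>) * measure_pmf.expectation (replicate_pmf b Q) (\<lambda>I. (norm (\<delta> I))\<^sup>2)"
    using svrg_estimate_unbiased[OF b, of xt y] by (simp add: int \<delta>_def del: Bochner_Integration.integral_diff)
  also have "\<dots> \<le> c + a\<^sup>2 / (2 * \<kappa>) * (2 * Lbar / real b * gradient_gap xt y)"
    unfolding \<delta>_def using \<kappa>(2)
    by (intro add_left_mono mult_left_mono svrg_estimate_variance b) simp
  also have "a\<^sup>2 / (2 * \<kappa>) * (2 * Lbar / real b * gradient_gap xt y)
      \<le> a * (gradient_gap xt y / (2 * \<gamma>))"
  proof -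
    have gap: "0 \<le> gradient_gap xt y"
      unfolding gradient_gap_def using L_pos
      by (intro mult_nonneg_nonneg sum_nonneg divide_nonneg_nonneg) (auto intro: less_imp_le)
    have "a\<^sup>2 / (2 * \<kappa>) * (2 * Lbar / real b * gradient_gap xt y)
        = 2 * a / (real m + 1) * (a * (gradient_gap xt y / (2 * \<gamma>)))"
      using b Lbar_pos by (simp add: \<kappa>_def power2_eq_square ac_simps)
    also have "\<dots> \<le> 1 * (a * (gradient_gap xt y / (2 * \<gamma>)))"
      using k gap \<gamma> by (intro mult_right_mono) (auto simp: a_def field_simps)
    finally show ?thesis by simp
  qed
  also have "c + a * (gradient_gap xt y / (2 * \<gamma>)) \<le> stage_potential \<eta> yt u k st + a * T"
  proof -
    have "a * (F y + inner (gradient F y) (u - y) + R u + gradient_gap xt y / (2 * \<gamma>)) \<le> a * T"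
      by (intro mult_left_mono T) (simp add: a_def)
    thus ?thesis by (simp add: c_def distrib_left)
  qed
  finally show ?thesis by (simp add: a_def)
qed

lemma finite_set_accsvrda_iter: "finite (set_pmf (accsvrda_iter n f R yt xt \<eta> b Q k))"
  by (induction k) (simp_all add: finite_set_minibatch)

lemma accsvrda_iter_minimizes:
  assumes "\<eta> > 0" "st \<in> set_pmf (accsvrda_iter n f R yt xt \<eta> b Q k)"
  shows "minimizes_dual_model \<eta> yt k st"
proof (cases k)
  case 0
  thus ?thesis using assms by (simp add: minimizes_dual_model_def dual_model_def weight_def)
next
  case (Suc j)
  thus ?thesis using assms accsvrda_step_minimizes by auto
qed

lemma expected_stage_potential:
  assumes b: "b \<ge> 1" and \<gamma>: "\<gamma> > 0" and \<eta>: "\<eta> > 0" "\<eta> = step_size n L \<gamma> m b"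
    and T: "\<And>y. F y + inner (gradient F y) (u - y) + R u + gradient_gap xt y / (2 * \<gamma>) \<le> T"
    and "k \<le> m"
  shows "measure_pmf.expectation (accsvrda_iter n f R yt xt \<eta> b Q k) (stage_potential \<eta> yt u k)
    \<le> weight k * T + (norm (u - yt))\<^sup>2 / (2 * \<eta>)"
  using \<open>k \<le> m\<close>
proof (induction k)
  case 0
  show ?case by (simp add: stage_potential_def dual_model_def weight_def)
next
  case (Suc k)
  have "measure_pmf.expectation (accsvrda_iter n f R yt xt \<eta> b Q (Suc k))
        (stage_potential \<eta> yt u (Suc k))
      \<le> measure_pmf.expectation (accsvrda_iter n f R yt xt \<eta> b Q k) (stage_potential \<eta> yt u k)
        + (real k + 1) / 2 * T"
    unfolding accsvrda_iter.simps
  proof (rule expectation_bind_le)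
    fix st assume "st \<in> set_pmf (accsvrda_iter n f R yt xt \<eta> b Q k)"
    hence inv: "minimizes_dual_model \<eta> yt k st" by (rule accsvrda_iter_minimizes[OF \<eta>(1)])
    show "measure_pmf.expectation (replicate_pmf b Q \<bind>
          (\<lambda>I. return_pmf (accsvrda_step n f R yt xt \<eta> b Q (Suc k) I st)))
          (stage_potential \<eta> yt u (Suc k))
        \<le> stage_potential \<eta> yt u k st + (real k + 1) / 2 * T"
      using stage_potential_expected_step[OF b \<gamma> \<eta>(2) Suc.prems inv T]
      by (simp add: expectation_bind_finite finite_set_minibatch)
  qed (simp_all add: finite_set_accsvrda_iter finite_set_minibatch)
  thus ?case using Suc by (simp add: weight_Suc distrib_right)
qed

lemma finite_set_one_stage: "finite (set_pmf (one_stage_accsvrda n f R yt xt \<eta> m b Q))"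
  by (simp add: one_stage_accsvrda_def finite_set_accsvrda_iter)

text \<open>The quadratic growth of the final model at \<open>u\<close> provides the term in \<open>z\<close>, which lets the
  stages be chained.\<close>

lemma one_stage_bound:
  assumes b: "b \<ge> 1" and \<gamma>: "\<gamma> > 0" and \<eta>: "\<eta> > 0" "\<eta> = step_size n L \<gamma> m b"
    and T: "\<And>y. F y + inner (gradient F y) (u - y) + R u + gradient_gap xt y / (2 * \<gamma>) \<le> T"
  shows "measure_pmf.expectation (one_stage_accsvrda n f R yt xt \<eta> m b Q)
      (\<lambda>(x, z). weight m * P x + (norm (u - z))\<^sup>2 / (2 * \<eta>))
    \<le> weight m * T + (norm (u - yt))\<^sup>2 / (2 * \<eta>)"
proof -
  have "measure_pmf.expectation (one_stage_accsvrda n f R yt xt \<eta> m b Q)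
      (\<lambda>(x, z). weight m * P x + (norm (u - z))\<^sup>2 / (2 * \<eta>))
    \<le> measure_pmf.expectation (accsvrda_iter n f R yt xt \<eta> b Q m) (stage_potential \<eta> yt u m)"
    unfolding one_stage_accsvrda_def integral_map_pmf
  proof (rule expectation_mono_finite[OF finite_set_accsvrda_iter])
    fix st assume "st \<in> set_pmf (accsvrda_iter n f R yt xt \<eta> b Q m)"
    hence inv: "minimizes_dual_model \<eta> yt m st" by (rule accsvrda_iter_minimizes[OF \<eta>(1)])
    obtain x z g where st: "st = (x, z, g)" by (cases st)
    have "dual_model \<eta> yt m g z + (norm (u - z))\<^sup>2 / (2 * \<eta>) \<le> dual_model \<eta> yt m g u"
      using inv by (simp add: st minimizes_dual_model_def)
    thus "(case case st of (x, z, gbar) \<Rightarrow> (x, z) of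
          (x, z) \<Rightarrow> weight m * P x + (norm (u - z))\<^sup>2 / (2 * \<eta>)) \<le> stage_potential \<eta> yt u m st"
      by (simp add: st stage_potential_def)
  qed
  also have "\<dots> \<le> weight m * T + (norm (u - yt))\<^sup>2 / (2 * \<eta>)"
    by (rule expected_stage_potential[OF b \<gamma> \<eta> T]) simp
  finally show ?thesis .
qed

section \<open>The outer momentum scheme\<close>

text \<open>The tangent at \<open>y\<close> falls short of \<open>F\<close> at \<open>xt\<close> and at \<open>xstar\<close> by Bregman divergences,
  weighted \<open>1 - 1 / \<theta>\<close> and \<open>1 / \<theta>\<close>. The two alternatives for \<open>\<rho>\<close> say which of the two
  shortfalls absorbs the gradient gap. Using the one at \<open>xt\<close> is free, and using the one at \<open>xstar\<close>
  costs \<open>\<rho> = 1 / \<gamma>\<close>.\<close>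

lemma stage_target_bound:
  assumes \<theta>: "\<theta> \<ge> 1" and \<gamma>: "\<gamma> > 0"
    and \<rho>: "(\<rho> = 0 \<and> 1 / (2 * \<gamma>) \<le> 1 - 1 / \<theta>) \<or> (\<rho> = 1 / \<gamma> \<and> 1 / \<gamma> \<le> 1 / \<theta>)"
    and u: "u = (1 - 1 / \<theta>) *\<^sub>R xt + (1 / \<theta>) *\<^sub>R xstar"
  shows "F y + inner (gradient F y) (u - y) + R u + gradient_gap xt y / (2 * \<gamma>)
    \<le> P xstar + (1 - 1 / \<theta> + \<rho>) * (P xt - P xstar)"
proof -
  define \<tau> where "\<tau> = 1 / \<theta>"
  have \<tau>: "0 \<le> \<tau>" "\<tau> \<le> 1" using \<theta> by (simp_all add: \<tau>_def)
  have split: "u - y = (1 - \<tau>) *\<^sub>R (xt - y) + \<tau> *\<^sub>R (xstar - y)"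
    by (simp add: u \<tau>_def algebra_simps)
  have tangent: "F y + inner (gradient F y) (u - y)
      = (1 - \<tau>) * (F xt - bregman F xt y) + \<tau> * (F xstar - bregman F xstar y)"
    by (simp only: split inner_add_right inner_scaleR_right) (simp add: bregman_def algebra_simps)
  have R_u: "R u \<le> (1 - \<tau>) * R xt + \<tau> * R xstar"
    unfolding u \<tau>_def[symmetric] by (rule convex_onD[OF R_convex]) (use \<tau> in auto)
  have gap: "gradient_gap xt y / (2 * \<gamma>)
      \<le> (1 - \<tau>) * bregman F xt y + \<tau> * bregman F xstar y + \<rho> * (P xt - P xstar)"
    using \<rho>
  proof
    assume \<rho>: "\<rho> = 0 \<and> 1 / (2 * \<gamma>) \<le> 1 - 1 / \<theta>"
    have "gradient_gap xt y / (2 * \<gamma>) \<le> 1 / (2 * \<gamma>) * bregman F xt y"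
      using gradient_gap_le_bregman[of xt y] \<gamma> by (simp add: divide_right_mono)
    also have "\<dots> \<le> (1 - \<tau>) * bregman F xt y"
      using \<rho> by (intro mult_right_mono bregman_F_nonneg) (simp add: \<tau>_def)
    finally show ?thesis
      using \<rho> mult_nonneg_nonneg[OF \<tau>(1) bregman_F_nonneg[of xstar y]] by simp
  next
    assume \<rho>: "\<rho> = 1 / \<gamma> \<and> 1 / \<gamma> \<le> 1 / \<theta>"
    have "gradient_gap xt y / (2 * \<gamma>) \<le> 2 * (bregman F xstar y + (P xt - P xstar)) / (2 * \<gamma>)"
      using \<gamma> by (intro divide_right_mono gradient_gap_le_via_minimizer) simp
    also have "\<dots> = 1 / \<gamma> * bregman F xstar y + \<rho> * (P xt - P xstar)"
      using \<gamma> by (simp add: conjunct1[OF \<rho>] field_simps)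
    also have "1 / \<gamma> * bregman F xstar y \<le> \<tau> * bregman F xstar y"
      using \<rho> by (intro mult_right_mono bregman_F_nonneg) (simp add: \<tau>_def)
    moreover have "0 \<le> (1 - \<tau>) * bregman F xt y"
      using \<tau> bregman_F_nonneg by simp
    ultimately show ?thesis by linarith
  qed
  have "(1 - \<tau>) * (F xt - bregman F xt y) + \<tau> * (F xstar - bregman F xstar y)
      + ((1 - \<tau>) * R xt + \<tau> * R xstar)
      + ((1 - \<tau>) * bregman F xt y + \<tau> * bregman F xstar y + \<rho> * (P xt - P xstar))
    = P xstar + (1 - \<tau> + \<rho>) * (P xt - P xstar)"
    by (simp add: P_def algebra_simps)
  thus ?thesis using tangent R_u gap unfolding \<tau>_def[symmetric] by linarith
qed

definition outer_potential :: "real \<Rightarrow> real \<Rightarrow> nat \<Rightarrow> 'a \<times> 'a \<times> 'a \<Rightarrow> real" where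
  "outer_potential \<gamma> C s = (\<lambda>(xp, x, z). (real s + 2)\<^sup>2 * (P x - P xstar)
     + C * (norm (outer_theta \<gamma> s *\<^sub>R z - (outer_theta \<gamma> s - 1) *\<^sub>R xp - xstar))\<^sup>2)"

end

text \<open>This makes the reference point of every stage a convex combination. The bound is attained at
  the first stage with \<open>\<gamma> = 3\<close>.\<close>

lemma outer_theta_Suc_ge_1:
  assumes "\<gamma> \<ge> 3"
  shows "outer_theta \<gamma> (Suc s) \<ge> 1"
proof -
  have "2 / 3 * 3 \<le> (1 - 1 / \<gamma>) * (real s + 3)"
    using assms by (intro mult_mono) (auto simp: field_simps)
  thus ?thesis by (simp add: outer_theta_def add.commute)
qed

text \<open>The weights \<open>(s + 2)\<^sup>2\<close> telescope. From the second stage on the free alternative is available,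
  and \<open>\<theta> \<le> (s + 3) / 2\<close> gives \<open>(s + 3)\<^sup>2 * (1 - 1 / \<theta>) \<le> (s + 3) * (s + 1)\<close>. At the first stage
  the charge \<open>1 / \<gamma>\<close> fits into the weight \<open>4\<close>.\<close>

lemma outer_theta_recursion:
  fixes s :: nat
  assumes \<gamma>: "\<gamma> \<ge> 3"
  defines "\<theta> \<equiv> outer_theta \<gamma> (Suc s)"
  obtains \<rho> where
    "(\<rho> = 0 \<and> 1 / (2 * \<gamma>) \<le> 1 - 1 / \<theta>) \<or> (\<rho> = 1 / \<gamma> \<and> 1 / \<gamma> \<le> 1 / \<theta>)"
    "(real s + 3)\<^sup>2 * (1 - 1 / \<theta> + \<rho>) \<le> (real s + 2)\<^sup>2"
proof -
  define t where "t = 1 / \<gamma>"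
  have t: "0 < t" "t \<le> 1 / 3" using \<gamma> by (auto simp: t_def field_simps)
  have \<theta>: "\<theta> = (1 - t) * (real s + 3) / 2"
    by (simp add: \<theta>_def outer_theta_def t_def)
  show thesis
  proof (cases s)
    case 0
    hence \<theta>0: "\<theta> = 3 * (1 - t) / 2" by (simp add: \<theta>)
    show thesis
    proof (rule that[of t], goal_cases)
      case 1
      have "t * \<theta> \<le> 1 / 3 * (3 / 2)" unfolding \<theta>0 using t by (intro mult_mono) auto
      hence "t * \<theta> \<le> 1" by simp
      moreover have "\<theta> > 0" using t by (simp add: \<theta>0)
      ultimately have "t \<le> 1 / \<theta>" by (simp add: field_simps)
      thus ?case by (simp add: t_def)
    next
      case 2
      \<comment> \<open>The claim \<open>9 - 6 / (1 - t) + 9 * t \<le> 4\<close> amounts to \<open>9 * t\<^sup>2 - 4 * t + 1 \<ge> 0\<close>;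
        complete the square.\<close>
      have "0 \<le> (3 * t - 2 / 3)\<^sup>2 + 5 / 9" by simp
      hence "5 + 9 * t \<le> 6 / (1 - t)"
        using t by (simp add: pos_le_divide_eq power2_eq_square algebra_simps)
      moreover have "9 * (1 / \<theta>) = 6 / (1 - t)" 
      proof -
        have "9 * (1 / (3 * r / 2)) = 6 / r" for r :: real by (cases "r = 0") simp_all
        thus ?thesis unfolding \<theta>0 .
      qed
      ultimately show ?case using 0 by (simp add: algebra_simps)
    qed
  next
    case (Suc j)
    hence s1: "real s \<ge> 1" by simp
    show thesis
    proof (rule that[of 0], goal_cases)
      case 1
      have "2 / 3 * 4 \<le> (1 - t) * (real s + 3)"
        using t s1 by (intro mult_mono) auto
      hence "\<theta> \<ge> 4 / 3" by (simp add: \<theta>)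
      hence "1 / \<theta> \<le> 3 / 4" by (simp add: field_simps)
      moreover have "1 / (2 * \<gamma>) \<le> 1 / 6" using \<gamma> by (simp add: field_simps)
      ultimately show ?case by simp
    next
      case 2
      have "\<theta> > 0" "\<theta> \<le> (real s + 3) / 2"
        using t s1 by (auto simp: \<theta> intro!: mult_left_le_one_le)
      hence "1 / \<theta> \<ge> 2 / (real s + 3)" by (simp add: field_simps)
      hence "(real s + 3)\<^sup>2 * (1 - 1 / \<theta> + 0) \<le> (real s + 3)\<^sup>2 * (1 - 2 / (real s + 3))"
        by (intro mult_left_mono) auto
      also have "\<dots> = (real s + 3) * (real s + 1)"
      proof -
        have "real s + 3 \<noteq> 0" by linarith
        thus ?thesis by (simp add: power2_eq_square field_simps)
      qed
      also have "\<dots> \<le> (real s + 2)\<^sup>2" by (simp add: power2_eq_square algebra_simps)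
      finally show ?case .
    qed
  qed
qed

context composite_problem
begin

text \<open>Multiplying \<open>one_stage_bound\<close> by \<open>K = (s + 3)\<^sup>2 / weight m\<close> puts the weight
  \<open>(s + 3)\<^sup>2\<close> on the objective gap. The constant \<open>C\<close> does not depend on \<open>s\<close> because the squared distances to the reference
  point carry a factor \<open>1 / \<theta>\<^sup>2\<close> and \<open>\<theta>\<close> is proportional to \<open>s + 3\<close>.\<close>

lemma outer_potential_expected_step:
  assumes \<gamma>: "\<gamma> \<ge> 3" and m: "m \<ge> 1" and b: "b \<ge> 1" and \<eta>_def: "\<eta> = step_size n L \<gamma> m b"
    and C: "C = 8 / ((1 - 1 / \<gamma>)\<^sup>2 * \<eta> * (real m + 1) * real m)"
  shows "measure_pmf.expectation
      (one_stage_accsvrda n f R (outer_extrapolation \<gamma> (Suc s) xpp xp zp) xp \<eta> m b Q)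
      (\<lambda>(x, z). outer_potential \<gamma> C (Suc s) (xp, x, z))
    \<le> outer_potential \<gamma> C s (xpp, xp, zp)"
proof -
  define \<theta> \<theta>p where "\<theta> = outer_theta \<gamma> (Suc s)" and "\<theta>p = outer_theta \<gamma> s"
  define yt where "yt = outer_extrapolation \<gamma> (Suc s) xpp xp zp"
  define u where "u = (1 - 1 / \<theta>) *\<^sub>R xp + (1 / \<theta>) *\<^sub>R xstar"
  define v where "v = \<theta>p *\<^sub>R zp - (\<theta>p - 1) *\<^sub>R xpp"
  define K where "K = (real s + 3)\<^sup>2 / weight m"
  have \<theta>: "\<theta> \<ge> 1" unfolding \<theta>_def by (rule outer_theta_Suc_ge_1[OF \<gamma>])
  have \<gamma>0: "\<gamma> > 0" using \<gamma> by simp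
  have \<eta>: "\<eta> > 0"
    using b \<gamma>0 Lbar_pos by (simp add: \<eta>_def step_size_def add_pos_pos)
  have W: "weight m > 0" by (rule weight_pos[OF m])
  have K0: "K \<ge> 0" and KW: "K * weight m = (real s + 3)\<^sup>2" using W by (simp_all add: K_def)
  have KC: "K * (r / (2 * \<eta>)) = C * (\<theta>\<^sup>2 * r)" for r
  proof -
    have "e\<^sup>2 / (M * N / 4) * (r / (2 * \<eta>)) = 8 / (d\<^sup>2 * \<eta> * N * M) * ((d * e / 2)\<^sup>2 * r)"
      if "d \<noteq> 0" "M \<noteq> 0" "N \<noteq> 0" for d e M N :: real
      using that \<eta> by (simp add: field_simps power2_eq_square)
    from this[of "1 - 1 / \<gamma>" "real m" "real m + 1" "real s + 3"] show ?thesis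
      using \<gamma> m unfolding K_def C \<theta>_def outer_theta_def weight_def
      by (simp add: add.commute[of _ 3] add_nonneg_eq_0_iff)
  qed
  obtain \<rho> where \<rho>:
    "(\<rho> = 0 \<and> 1 / (2 * \<gamma>) \<le> 1 - 1 / \<theta>) \<or> (\<rho> = 1 / \<gamma> \<and> 1 / \<gamma> \<le> 1 / \<theta>)"
    "(real s + 3)\<^sup>2 * (1 - 1 / \<theta> + \<rho>) \<le> (real s + 2)\<^sup>2"
    unfolding \<theta>_def by (rule outer_theta_recursion[OF \<gamma>, of s])
  define T where "T = P xstar + (1 - 1 / \<theta> + \<rho>) * (P xp - P xstar)"
  have dist_z: "C * (norm (\<theta> *\<^sub>R z - (\<theta> - 1) *\<^sub>R xp - xstar))\<^sup>2 = K * ((norm (u - z))\<^sup>2 / (2 * \<eta>))" for z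
  proof -
    have "\<theta> *\<^sub>R z - (\<theta> - 1) *\<^sub>R xp - xstar = (- \<theta>) *\<^sub>R (u - z)"
      using \<theta> by (simp add: u_def algebra_simps)
    hence "(norm (\<theta> *\<^sub>R z - (\<theta> - 1) *\<^sub>R xp - xstar))\<^sup>2 = \<theta>\<^sup>2 * (norm (u - z))\<^sup>2"
      by (simp add: power_mult_distrib)
    thus ?thesis by (simp only: KC)
  qed
  have dist_y: "K * ((norm (u - yt))\<^sup>2 / (2 * \<eta>)) = C * (norm (v - xstar))\<^sup>2"
  proof -
    have "\<theta> *\<^sub>R yt = \<theta> *\<^sub>R xp + (\<theta>p - 1) *\<^sub>R (xp - xpp) + \<theta>p *\<^sub>R (zp - xp)"
      using \<theta> by (simp add: yt_def outer_extrapolation_def \<theta>_def[symmetric] \<theta>p_def[symmetric] scaleR_add_right)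
    hence "v - xstar = \<theta> *\<^sub>R yt - \<theta> *\<^sub>R u"
      using \<theta> by (simp add: v_def u_def algebra_simps)
    also have "\<dots> = (- \<theta>) *\<^sub>R (u - yt)" by (simp add: algebra_simps)
    finally have "(norm (v - xstar))\<^sup>2 = \<theta>\<^sup>2 * (norm (u - yt))\<^sup>2"
      by (simp add: power_mult_distrib)
    thus ?thesis by (simp only: KC)
  qed
  have pot: "outer_potential \<gamma> C (Suc s) (xp, x, z)
      = K * (weight m * P x + (norm (u - z))\<^sup>2 / (2 * \<eta>)) - (real s + 3)\<^sup>2 * P xstar" for x z
    unfolding outer_potential_def distrib_left mult.assoc[symmetric, of K "weight m"] KW dist_z[symmetric]
    by (simp add: \<theta>_def algebra_simps)
  note int = integrable_measure_pmf_finite[OF finite_set_one_stage]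
  have "measure_pmf.expectation (one_stage_accsvrda n f R yt xp \<eta> m b Q)
      (\<lambda>(x, z). outer_potential \<gamma> C (Suc s) (xp, x, z))
    = K * measure_pmf.expectation (one_stage_accsvrda n f R yt xp \<eta> m b Q)
        (\<lambda>(x, z). weight m * P x + (norm (u - z))\<^sup>2 / (2 * \<eta>)) - (real s + 3)\<^sup>2 * P xstar"
    unfolding pot case_prod_unfold by (simp add: int del: Bochner_Integration.integral_add)
  also have "\<dots> \<le> K * (weight m * T + (norm (u - yt))\<^sup>2 / (2 * \<eta>)) - (real s + 3)\<^sup>2 * P xstar"
    unfolding T_def
    by (intro diff_right_mono mult_left_mono K0 one_stage_bound[OF b \<gamma>0 \<eta> \<eta>_def]
        stage_target_bound[OF \<theta> \<gamma>0 \<rho>(1) u_def])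
  also have "\<dots> = (real s + 3)\<^sup>2 * (T - P xstar) + C * (norm (v - xstar))\<^sup>2"
    unfolding distrib_left dist_y mult.assoc[symmetric, of K "weight m"] KW by (simp add: algebra_simps)
  also have "\<dots> = ((real s + 3)\<^sup>2 * (1 - 1 / \<theta> + \<rho>)) * (P xp - P xstar) + C * (norm (v - xstar))\<^sup>2"
    by (simp add: T_def)
  also have "\<dots> \<le> (real s + 2)\<^sup>2 * (P xp - P xstar) + C * (norm (v - xstar))\<^sup>2"
    using xstar_min[of xp] by (intro add_right_mono mult_right_mono \<rho>(2)) (simp add: P_def)
  also have "\<dots> = outer_potential \<gamma> C s (xpp, xp, zp)"
    by (simp add: outer_potential_def v_def \<theta>p_def)
  finally show ?thesis by (simp add: yt_def)
qed

lemma finite_set_dasvrda_ns_iter: "finite (set_pmf (dasvrda_ns_iter n f R x0 z0 \<gamma> L m b s))"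
  by (induction s) (auto simp: finite_set_one_stage split: prod.splits)

lemma expected_outer_potential:
  assumes \<gamma>: "\<gamma> \<ge> 3" and m: "m \<ge> 1" and b: "b \<ge> 1" and \<eta>: "\<eta> = step_size n L \<gamma> m b"
    and C: "C = 8 / ((1 - 1 / \<gamma>)\<^sup>2 * \<eta> * (real m + 1) * real m)"
  shows "measure_pmf.expectation (dasvrda_ns_iter n f R x0 z0 \<gamma> L m b s) (outer_potential \<gamma> C s)
    \<le> 4 * (P x0 - P xstar) + C * (norm (z0 - xstar))\<^sup>2"
proof (induction s)
  case 0
  \<comment> \<open>Both \<open>z\<close> and the previous iterate start at \<open>z0\<close>, so the combined point is \<open>z0\<close>.\<close>
  show ?case by (simp add: outer_potential_def algebra_simps)
next
  case (Suc s)
  have "measure_pmf.expectation (dasvrda_ns_iter n f R x0 z0 \<gamma> L m b (Suc s))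
      (outer_potential \<gamma> C (Suc s))
    \<le> measure_pmf.expectation (dasvrda_ns_iter n f R x0 z0 \<gamma> L m b s) (outer_potential \<gamma> C s) + 0"
    unfolding dasvrda_ns_iter.simps
  proof (rule expectation_bind_le[OF finite_set_dasvrda_ns_iter])
    fix st :: "'a \<times> 'a \<times> 'a"
    obtain xpp xp zp where st: "st = (xpp, xp, zp)" by (cases st)
    let ?step = "\<lambda>(xpp, xp, zp).
      one_stage_accsvrda n f R (outer_extrapolation \<gamma> (Suc s) xpp xp zp) xp
        (step_size n L \<gamma> m b) m b Q \<bind> (\<lambda>(x, z). return_pmf (xp, x, z))"
    show "finite (set_pmf (?step st))"
      by (auto simp: st finite_set_one_stage)
    show "measure_pmf.expectation (?step st) (outer_potential \<gamma> C (Suc s))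
        \<le> outer_potential \<gamma> C s st + 0"
      using outer_potential_expected_step[OF assms, of s xpp xp zp]
      by (simp add: st expectation_bind_finite finite_set_one_stage \<eta> case_prod_unfold)
  qed
  thus ?case using Suc by linarith
qed

lemma dasvrda_ns_bound:
  assumes \<gamma>: "\<gamma> \<ge> 3" and m: "m \<ge> 1" and b: "b \<ge> 1" and \<eta>: "\<eta> = step_size n L \<gamma> m b"
  shows "measure_pmf.expectation (dasvrda_ns n f R x0 z0 \<gamma> L m b S) (\<lambda>x. P x - P xstar)
     \<le> 4 / (real S + 2)\<^sup>2 * (P x0 - P xstar)
       + 8 / ((1 - 1 / \<gamma>)\<^sup>2 * \<eta> * (real S + 2)\<^sup>2 * (real m + 1) * real m)
           * (norm (z0 - xstar))\<^sup>2"
proof -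
  define C where "C = 8 / ((1 - 1 / \<gamma>)\<^sup>2 * \<eta> * (real m + 1) * real m)"
  define q where "q = (real S + 2)\<^sup>2"
  have q: "q > 0" by (simp add: q_def add_nonneg_pos)
  have "\<eta> > 0"
    using b \<gamma> Lbar_pos by (simp add: \<eta> step_size_def add_pos_pos)
  hence C0: "C \<ge> 0" by (simp add: C_def)
  have "q * measure_pmf.expectation (dasvrda_ns n f R x0 z0 \<gamma> L m b S) (\<lambda>x. P x - P xstar)
      = measure_pmf.expectation (dasvrda_ns_iter n f R x0 z0 \<gamma> L m b S)
          (\<lambda>(xp, x, z). q * (P x - P xstar))"
    by (simp add: dasvrda_ns_def case_prod_unfold)
  also have "\<dots> \<le> measure_pmf.expectation (dasvrda_ns_iter n f R x0 z0 \<gamma> L m b S)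
      (outer_potential \<gamma> C S)"
    using C0 by (intro expectation_mono_finite finite_set_dasvrda_ns_iter)
      (auto simp: outer_potential_def q_def)
  also have "\<dots> \<le> 4 * (P x0 - P xstar) + C * (norm (z0 - xstar))\<^sup>2"
    by (rule expected_outer_potential[OF assms C_def])
  finally have "measure_pmf.expectation (dasvrda_ns n f R x0 z0 \<gamma> L m b S) (\<lambda>x. P x - P xstar)
      \<le> (4 * (P x0 - P xstar) + C * (norm (z0 - xstar))\<^sup>2) / q"
    using q by (simp add: pos_le_divide_eq mult.commute)
  also have "\<dots> = 4 / q * (P x0 - P xstar) + C / q * (norm (z0 - xstar))\<^sup>2"
    by (simp add: add_divide_distrib)
  also have "C / q = 8 / ((1 - 1 / \<gamma>)\<^sup>2 * \<eta> * q * (real m + 1) * real m)"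
    by (simp add: C_def ac_simps)
  finally show ?thesis unfolding q_def .
qed

end

section \<open>The convergence rate\<close>

theorem theorem5p1:
  fixes f :: "nat \<Rightarrow> real ^ 'd \<Rightarrow> real"
    and R F P :: "real ^ 'd \<Rightarrow> real"
    and L :: "nat \<Rightarrow> real"
    and x0 z0 xstar :: "real ^ 'd"
    and \<gamma> \<eta> :: real
    and n m b S :: nat
  assumes "n \<ge> 1"
    and "\<And>i. i \<in> {1..n} \<Longrightarrow> convex_on UNIV (f i)"
    and "\<And>i x. i \<in> {1..n} \<Longrightarrow> f i differentiable (at x)"
    and "\<And>i. i \<in> {1..n} \<Longrightarrow> L i > 0"
    and "\<And>i x y. i \<in> {1..n} \<Longrightarrow>
           norm (gradient (f i) x - gradient (f i) y) \<le> L i * norm (x - y)"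
    and "convex_on UNIV R"
    and "F = average n f"
    and "P = (\<lambda>x. F x + R x)"
    and "\<And>x. P xstar \<le> P x"
    and "\<gamma> \<ge> 3"
    and "m \<ge> 1"
    and "b \<in> {1..n}"
    and "S \<ge> 1"
    and "\<eta> = step_size n L \<gamma> m b"
  shows "measure_pmf.expectation (dasvrda_ns n f R x0 z0 \<gamma> L m b S) (\<lambda>x. P x - P xstar)
     \<le> 4 / (real S + 2)\<^sup>2 * (P x0 - P xstar)
       + 8 / ((1 - 1 / \<gamma>)\<^sup>2 * \<eta> * (real S + 2)\<^sup>2 * (real m + 1) * real m)
           * (norm (z0 - xstar))\<^sup>2"
proof -
  interpret composite_problem n f R L xstar
    using assms(1-6) assms(9) unfolding assms(7,8) by unfold_locales auto
  have "P = composite_problem.P n f R"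
    by (simp add: fun_eq_iff P_def assms(7,8))
  thus ?thesis
    using dasvrda_ns_bound[OF assms(10,11) _ assms(14), of x0 z0 S] assms(12) by simp
qed

end
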